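(* Let $B$ be a Boolean algebra and let $\mu_0:B\to[0,1]$ be an additive function. Let $CB(B)$ be the free abstract $\sigma$-algebra on the Boolean algebra $B$, with unit $\eta:B\to CB(B)$. Then there exists a unique measure $\mu:CB(B)\to[0,1]$ such that $\mu\circ\eta=\mu_0$.
   Context: An abstract $\sigma$-algebra is a Boolean algebra in which all countable joins exist. A morphism of abstract $\sigma$-algebras is a map preserving order, $0$, $1$, complements and countable joins (hence also countable meets). An additive function on a Boolean algebra $B$ is a function $\mu_0:B\to[0,\infty]$ with $\mu_0(0)=0$ and $\mu_0(a\vee b)=\mu_0(a)+\mu_0(b)$ whenever $a\wedge b=0$. A measure on an abstract $\sigma$-algebra $\Sigma$ is a function $\mu:\Sigma\to[0,\infty]$ with $\mu(0)=0$ and $\mu(\bigvee_{i=0}^\infty a_i)=\sum_{i=0}^\infty\mu(a_i)$ whenever $a_i\wedge a_j=0$ for all $i\ne j$. $CB(\cdot)$ denotes the left adjoint of the forgetful functor from abstract $\sigma$-algebras to Boolean algebras. So $\eta:B\to CB(B)$ is a morphism of Boolean algebras such that every morphism of Boolean algebras from $B$ to an abstract $\sigma$-algebra $\Sigma$ factors as $\phi\circ\eta$ for a unique morphism of abstract $\sigma$-algebras $\phi:CB(B)\to\Sigma$. *)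

theory Defs
  imports "HOL-Analysis.Analysis" "HOL-Algebra.Lattice"
begin

section \<open>Boolean algebras and abstract sigma-algebras\<close>

locale boolean_alg = bounded_lattice +
  assumes meet_join_distrib:
    "\<lbrakk>x \<in> carrier L; y \<in> carrier L; z \<in> carrier L\<rbrakk> \<Longrightarrow> x \<sqinter> (y \<squnion> z) = (x \<sqinter> y) \<squnion> (x \<sqinter> z)"
    and complement_exists:
    "x \<in> carrier L \<Longrightarrow> \<exists>y\<in>carrier L. x \<sqinter> y = \<bottom> \<and> x \<squnion> y = \<top>"

definition complement :: "('a, 'm) gorder_scheme \<Rightarrow> 'a \<Rightarrow> 'a" where
  "complement L x = (THE y. y \<in> carrier L \<and> x \<sqinter>\<^bsub>L\<^esub> y = \<bottom>\<^bsub>L\<^esub> \<and> x \<squnion>\<^bsub>L\<^esub> y = \<top>\<^bsub>L\<^esub>)"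

locale abstract_sigma_algebra = boolean_alg +
  assumes countable_join_exists:
    "\<lbrakk>A \<subseteq> carrier L; countable A\<rbrakk> \<Longrightarrow> \<exists>s. least L s (Upper L A)"

definition boolean_morphism ::
    "('a, 'm) gorder_scheme \<Rightarrow> ('b, 'n) gorder_scheme \<Rightarrow> ('a \<Rightarrow> 'b) \<Rightarrow> bool" where
  "boolean_morphism X Y f \<longleftrightarrow>
     f \<in> carrier X \<rightarrow> carrier Y \<and>
     f \<bottom>\<^bsub>X\<^esub> = \<bottom>\<^bsub>Y\<^esub> \<and> f \<top>\<^bsub>X\<^esub> = \<top>\<^bsub>Y\<^esub> \<and>
     (\<forall>x\<in>carrier X. f (complement X x) = complement Y (f x)) \<and>
     (\<forall>x\<in>carrier X. \<forall>y\<in>carrier X. f (x \<squnion>\<^bsub>X\<^esub> y) = f x \<squnion>\<^bsub>Y\<^esub> f y) \<and>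
     (\<forall>x\<in>carrier X. \<forall>y\<in>carrier X. f (x \<sqinter>\<^bsub>X\<^esub> y) = f x \<sqinter>\<^bsub>Y\<^esub> f y)"

definition sigma_morphism ::
    "('a, 'm) gorder_scheme \<Rightarrow> ('b, 'n) gorder_scheme \<Rightarrow> ('a \<Rightarrow> 'b) \<Rightarrow> bool" where
  "sigma_morphism X Y f \<longleftrightarrow>
     f \<in> carrier X \<rightarrow> carrier Y \<and>
     (\<forall>x\<in>carrier X. \<forall>y\<in>carrier X. x \<sqsubseteq>\<^bsub>X\<^esub> y \<longrightarrow> f x \<sqsubseteq>\<^bsub>Y\<^esub> f y) \<and>
     f \<bottom>\<^bsub>X\<^esub> = \<bottom>\<^bsub>Y\<^esub> \<and> f \<top>\<^bsub>X\<^esub> = \<top>\<^bsub>Y\<^esub> \<and>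
     (\<forall>x\<in>carrier X. f (complement X x) = complement Y (f x)) \<and>
     (\<forall>A. A \<subseteq> carrier X \<and> countable A \<longrightarrow> f (\<Squnion>\<^bsub>X\<^esub> A) = \<Squnion>\<^bsub>Y\<^esub> (f ` A))"

section \<open>Additive functions and measures\<close>

definition additive_function :: "('a, 'm) gorder_scheme \<Rightarrow> ('a \<Rightarrow> ennreal) \<Rightarrow> bool" where
  "additive_function B \<mu> \<longleftrightarrow>
     \<mu> \<bottom>\<^bsub>B\<^esub> = 0 \<and>
     (\<forall>a\<in>carrier B. \<forall>b\<in>carrier B. a \<sqinter>\<^bsub>B\<^esub> b = \<bottom>\<^bsub>B\<^esub> \<longrightarrow> \<mu> (a \<squnion>\<^bsub>B\<^esub> b) = \<mu> a + \<mu> b)"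

definition sigma_measure :: "('a, 'm) gorder_scheme \<Rightarrow> ('a \<Rightarrow> ennreal) \<Rightarrow> bool" where
  "sigma_measure S \<mu> \<longleftrightarrow>
     \<mu> \<bottom>\<^bsub>S\<^esub> = 0 \<and>
     (\<forall>a :: nat \<Rightarrow> 'a. range a \<subseteq> carrier S \<and> (\<forall>i j. i \<noteq> j \<longrightarrow> a i \<sqinter>\<^bsub>S\<^esub> a j = \<bottom>\<^bsub>S\<^esub>) \<longrightarrow>
        \<mu> (\<Squnion>\<^bsub>S\<^esub> (range a)) = (\<Sum>i. \<mu> (a i)))"

section \<open>The free abstract sigma-algebra on a Boolean algebra\<close>

text \<open>Morphisms only matter on the carrier; \<open>extensional\<close> fixes their values outside it, so that
  uniqueness of \<open>\<phi>\<close> means uniqueness on the carrier of \<open>C\<close>.\<close>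

definition factors_uniquely ::
    "'b gorder \<Rightarrow> 'c gorder \<Rightarrow> ('b \<Rightarrow> 'c) \<Rightarrow> 's gorder \<Rightarrow> bool" where
  "factors_uniquely B C \<eta> S \<longleftrightarrow>
     (\<forall>f. boolean_morphism B S f \<longrightarrow>
        (\<exists>!\<phi>. \<phi> \<in> extensional (carrier C) \<and> sigma_morphism C S \<phi> \<and>
              (\<forall>b\<in>carrier B. \<phi> (\<eta> b) = f b)))"

text \<open>A formula cannot quantify over the types that carry the target \<open>S\<close> of the universal property.
  It is therefore stated for two types of targets: that of \<open>C\<close> itself, and the type of formal
  expressions in elements of \<open>B\<close>, on which every abstract sigma-algebra generated by an image of
  \<open>B\<close> has an isomorphic copy.  The lemma \<open>free_sigma_algebra_universal\<close> below shows that this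
  gives the universal property for targets on every type, and \<open>free_sigma_algebra_exists\<close> that
  the free abstract sigma-algebra exists.\<close>

datatype 'b sigma_term =
  Gen 'b | Compl "'b sigma_term" | Join "nat \<Rightarrow> 'b sigma_term"

definition free_sigma_algebra :: "'b gorder \<Rightarrow> 'c gorder \<Rightarrow> ('b \<Rightarrow> 'c) \<Rightarrow> bool" where
  "free_sigma_algebra B C \<eta> \<longleftrightarrow>
     abstract_sigma_algebra C \<and> boolean_morphism B C \<eta> \<and>
     (\<forall>S :: 'c gorder. abstract_sigma_algebra S \<longrightarrow> factors_uniquely B C \<eta> S) \<and>
     (\<forall>S :: 'b sigma_term gorder. abstract_sigma_algebra S \<longrightarrow> factors_uniquely B C \<eta> S)"

section \<open>The universal property on arbitrary types, and existence\<close>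

lemma (in partial_order) sup_eqI: "least L s (Upper L A) \<Longrightarrow> \<Squnion> A = s"
  unfolding Lattice.sup_def by (rule some_equality) (auto intro: least_unique)

lemma (in partial_order) inf_eqI: "greatest L s (Lower L A) \<Longrightarrow> \<Sqinter> A = s"
  unfolding Lattice.inf_def by (rule some_equality) (auto intro: greatest_unique)

context boolean_alg
begin

lemma compl_unique_le:
  assumes "x \<in> carrier L" "y \<in> carrier L" "z \<in> carrier L"
    "x \<sqinter> y = \<bottom>" "x \<squnion> z = \<top>"
  shows "y \<sqsubseteq> z"
proof -
  have "y = y \<sqinter> (x \<squnion> z)"
    using assms by (metis join_closed le_iff_join top_higher)
  also have "\<dots> = (y \<sqinter> x) \<squnion> (y \<sqinter> z)" using assms by (intro meet_join_distrib)
  also have "\<dots> = y \<sqinter> z"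
    using assms by (metis bottom_join eq_is_equal meet_closed meet_comm)
  finally show ?thesis using assms by (metis le_iff_join)
qed

lemma complement_eqI:
  assumes "x \<in> carrier L" "y \<in> carrier L" "x \<sqinter> y = \<bottom>" "x \<squnion> y = \<top>"
  shows "complement L x = y"
  unfolding complement_def
proof (rule the_equality)
  fix z assume z: "z \<in> carrier L \<and> x \<sqinter> z = \<bottom> \<and> x \<squnion> z = \<top>"
  show "z = y"
    by (rule le_antisym[OF compl_unique_le compl_unique_le]) (use z assms in blast)+
qed (use assms in blast)

lemma complement_facts:
  assumes "x \<in> carrier L"
  shows "complement L x \<in> carrier L" "x \<sqinter> complement L x = \<bottom>" "x \<squnion> complement L x = \<top>"
  using complement_exists[OF assms] complement_eqI[OF assms] by auto

lemma meet_eq_complement: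
  assumes x: "x \<in> carrier L" and y: "y \<in> carrier L"
  shows "x \<sqinter> y = complement L (complement L x \<squnion> complement L y)"
proof -
  let ?x = "complement L x" and ?y = "complement L y"
  note c = complement_facts[OF x] complement_facts[OF y]
  let ?m = "x \<sqinter> y" and ?n = "?x \<squnion> ?y"
  have car: "?m \<in> carrier L" "?n \<in> carrier L" using x y c by auto
  have m: "?m \<sqsubseteq> x" "?m \<sqsubseteq> y" using x y by (simp_all add: meet_left meet_right)
  have le_bot: "z = \<bottom>" if "z \<in> carrier L" "z \<sqsubseteq> \<bottom>" for z
    by (rule le_antisym) (use that in auto)
  have "?m \<sqinter> u = \<bottom>" if u: "u \<in> carrier L" and z: "z \<in> carrier L" "?m \<sqsubseteq> z" "z \<sqinter> u = \<bottom>" for u z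
  proof (rule le_bot)
    have "?m \<sqinter> u \<sqsubseteq> z"
      by (rule le_trans[OF meet_left z(2)]) (use u z car in auto)
    then show "?m \<sqinter> u \<sqsubseteq> \<bottom>"
      unfolding z(3)[symmetric] by (rule meet_le) (use u z car in \<open>auto intro: meet_right\<close>)
  qed (use car u in simp)
  from this[OF c(1) x m(1) c(2)] this[OF c(4) y m(2) c(5)]
  have b: "?m \<sqinter> ?x = \<bottom>" "?m \<sqinter> ?y = \<bottom>" .
  have "\<bottom> \<squnion> \<bottom> = \<bottom>" using bottom_join[of \<bottom>] by (simp add: eq_is_equal)
  then have "?n \<sqinter> ?m = \<bottom>"
    using meet_join_distrib[OF car(1) c(1,4)] b by (simp add: meet_comm)
  moreover have "?n \<squnion> ?m = \<top>"
  proof -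
    have j: "?n \<squnion> ?m \<in> carrier L" "?n \<sqsubseteq> ?n \<squnion> ?m" "?m \<sqsubseteq> ?n \<squnion> ?m"
      using car by (simp_all add: join_left join_right)
    have xn: "?x \<sqsubseteq> ?n \<squnion> ?m"
      by (rule le_trans[OF join_left j(2)]) (use c car j in auto)
    have yn: "?y \<sqsubseteq> ?n \<squnion> ?m"
      by (rule le_trans[OF join_right j(2)]) (use c car j in auto)
    have "x \<sqinter> ?y \<sqsubseteq> ?n \<squnion> ?m"
      by (rule le_trans[OF meet_right yn]) (use x c j in auto)
    then have "?m \<squnion> (x \<sqinter> ?y) \<sqsubseteq> ?n \<squnion> ?m"
      using j x c car by (intro join_le) auto
    moreover have "x = ?m \<squnion> (x \<sqinter> ?y)"
      using meet_join_distrib[OF x y c(4)] c(6) le_iff_join[OF x top_closed] x by simp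
    ultimately have "x \<sqsubseteq> ?n \<squnion> ?m" by simp
    then have "x \<squnion> ?x \<sqsubseteq> ?n \<squnion> ?m" using xn x c j by (intro join_le) auto
    then have "\<top> \<sqsubseteq> ?n \<squnion> ?m" using c by simp
    then show ?thesis using j by (intro le_antisym) auto
  qed
  ultimately show ?thesis using car complement_eqI by simp
qed

end

context abstract_sigma_algebra
begin

lemma sup_lub: "\<lbrakk>A \<subseteq> carrier L; countable A\<rbrakk> \<Longrightarrow> least L (\<Squnion> A) (Upper L A)"
  using countable_join_exists sup_eqI by metis

lemma sup_in_carrier: "\<lbrakk>A \<subseteq> carrier L; countable A\<rbrakk> \<Longrightarrow> \<Squnion> A \<in> carrier L"
  using sup_lub least_closed by metis

lemma meet_glb:
  "\<lbrakk>x \<in> carrier L; y \<in> carrier L\<rbrakk> \<Longrightarrow> greatest L (x \<sqinter> y) (Lower L {x, y})"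
  unfolding meet_def using inf_of_two_exists inf_eqI by metis

lemma sup_empty: "\<Squnion> {} = \<bottom>"
  by (rule sup_eqI) (simp add: bottom_least)

end

lemma sigma_morphismD:
  assumes "sigma_morphism X Y f"
  shows "x \<in> carrier X \<Longrightarrow> f x \<in> carrier Y"
    "\<lbrakk>x \<in> carrier X; y \<in> carrier X; x \<sqsubseteq>\<^bsub>X\<^esub> y\<rbrakk> \<Longrightarrow> f x \<sqsubseteq>\<^bsub>Y\<^esub> f y"
    "f \<bottom>\<^bsub>X\<^esub> = \<bottom>\<^bsub>Y\<^esub>" "f \<top>\<^bsub>X\<^esub> = \<top>\<^bsub>Y\<^esub>"
    "x \<in> carrier X \<Longrightarrow> f (complement X x) = complement Y (f x)"
    "\<lbrakk>A \<subseteq> carrier X; countable A\<rbrakk> \<Longrightarrow> f (\<Squnion>\<^bsub>X\<^esub> A) = \<Squnion>\<^bsub>Y\<^esub> (f ` A)"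
  using assms unfolding sigma_morphism_def by auto

lemma boolean_morphismD:
  assumes "boolean_morphism X Y f"
  shows "x \<in> carrier X \<Longrightarrow> f x \<in> carrier Y"
    "f \<bottom>\<^bsub>X\<^esub> = \<bottom>\<^bsub>Y\<^esub>" "f \<top>\<^bsub>X\<^esub> = \<top>\<^bsub>Y\<^esub>"
    "x \<in> carrier X \<Longrightarrow> f (complement X x) = complement Y (f x)"
    "\<lbrakk>x \<in> carrier X; y \<in> carrier X\<rbrakk> \<Longrightarrow> f (x \<squnion>\<^bsub>X\<^esub> y) = f x \<squnion>\<^bsub>Y\<^esub> f y"
    "\<lbrakk>x \<in> carrier X; y \<in> carrier X\<rbrakk> \<Longrightarrow> f (x \<sqinter>\<^bsub>X\<^esub> y) = f x \<sqinter>\<^bsub>Y\<^esub> f y"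
  using assms unfolding boolean_morphism_def by auto

lemma sigma_morphism_comp:
  assumes f: "sigma_morphism X Y f" and g: "sigma_morphism Y Z g"
  shows "sigma_morphism X Z (\<lambda>x. g (f x))"
proof -
  have "g (f (\<Squnion>\<^bsub>X\<^esub> A)) = \<Squnion>\<^bsub>Z\<^esub> ((\<lambda>x. g (f x)) ` A)"
    if "A \<subseteq> carrier X" "countable A" for A
  proof -
    have "f ` A \<subseteq> carrier Y" using that sigma_morphismD(1)[OF f] by auto
    then show ?thesis
      using that sigma_morphismD(6)[OF f that] sigma_morphismD(6)[OF g, of "f ` A"]
      by (simp add: image_image)
  qed
  then show ?thesis
    using sigma_morphismD(1-5)[OF f] sigma_morphismD(1-5)[OF g]
    unfolding sigma_morphism_def by (simp add: Pi_iff)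
qed

lemma sigma_morphism_id: "sigma_morphism X X (\<lambda>x. x)"
  unfolding sigma_morphism_def by auto

lemma sigma_morphism_cong:
  assumes X: "abstract_sigma_algebra X" and fg: "\<And>x. x \<in> carrier X \<Longrightarrow> f x = g x"
    and f: "sigma_morphism X Y f"
  shows "sigma_morphism X Y g"
proof -
  interpret X: abstract_sigma_algebra X by (fact X)
  have "g (\<Squnion>\<^bsub>X\<^esub> A) = \<Squnion>\<^bsub>Y\<^esub> (g ` A)" if "A \<subseteq> carrier X" "countable A" for A
  proof -
    have "f ` A = g ` A" using that(1) fg by (auto intro!: image_cong)
    then show ?thesis
      using sigma_morphismD(6)[OF f that] fg[OF X.sup_in_carrier[OF that]] by simp
  qed
  then show ?thesis
    using sigma_morphismD(1-5)[OF f] fg[symmetric]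
    unfolding sigma_morphism_def by (simp add: Pi_iff X.complement_facts)
qed

definition sub_sigma :: "('a, 'm) gorder_scheme \<Rightarrow> 'a set \<Rightarrow> bool" where
  "sub_sigma S E \<longleftrightarrow> E \<subseteq> carrier S \<and> \<bottom>\<^bsub>S\<^esub> \<in> E \<and> \<top>\<^bsub>S\<^esub> \<in> E \<and>
     (\<forall>x\<in>E. complement S x \<in> E) \<and> (\<forall>A. A \<subseteq> E \<and> countable A \<longrightarrow> \<Squnion>\<^bsub>S\<^esub> A \<in> E)"

definition pull :: "('a \<Rightarrow> 's) \<Rightarrow> 'a set \<Rightarrow> 's gorder \<Rightarrow> 'a gorder" where
  "pull e X S = \<lparr>carrier = X, eq = (=), le = (\<lambda>x y. e x \<sqsubseteq>\<^bsub>S\<^esub> e y)\<rparr>"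

lemma pull_simps [simp]:
  "carrier (pull e X S) = X" "eq (pull e X S) = (=)"
  "le (pull e X S) x y \<longleftrightarrow> e x \<sqsubseteq>\<^bsub>S\<^esub> e y"
  by (simp_all add: pull_def)

lemma pull:
  fixes e :: "'a \<Rightarrow> 's" and S :: "'s gorder"
  assumes S: "abstract_sigma_algebra S" and inj: "inj_on e X" and sub: "sub_sigma S (e ` X)"
  shows pull_alg: "abstract_sigma_algebra (pull e X S)"
    and pull_morphism: "sigma_morphism (pull e X S) S e"
    and pull_boolean: "\<lbrakk>boolean_alg B; boolean_morphism B S f; f ` carrier B \<subseteq> e ` X\<rbrakk> \<Longrightarrow>
      boolean_morphism B (pull e X S) (\<lambda>b. inv_into X e (f b))"
proof -
  interpret S: abstract_sigma_algebra S by (fact S)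
  let ?R = "pull e X S"
  have car: "x \<in> X \<Longrightarrow> e x \<in> carrier S" for x using sub by (auto simp: sub_sigma_def)
  interpret R: partial_order ?R
    apply unfold_locales
             apply (auto simp: car)
    subgoal by (meson S.le_antisym car inj inj_onD)
    subgoal by (meson S.le_trans car)
    done
  have lub: "least ?R s (Upper ?R A)"
    if "least S (e s) (Upper S (e ` A))" "A \<subseteq> X" "s \<in> X" for s A
  proof (rule least_UpperI)
    show "x \<sqsubseteq>\<^bsub>?R\<^esub> s" if "x \<in> A" for x
      unfolding pull_simps
      by (rule least_Upper_above[OF \<open>least S (e s) _\<close>]) (use that \<open>A \<subseteq> X\<close> car in auto)
    show "s \<sqsubseteq>\<^bsub>?R\<^esub> y" if "y \<in> Upper ?R A" for y
    proof -
      have "e y \<in> Upper S (e ` A)" using that \<open>A \<subseteq> X\<close> car by (auto simp: Upper_def)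
      then show ?thesis using least_le[OF \<open>least S (e s) _\<close>] by simp
    qed
  qed (use that in auto)
  have glb: "greatest ?R s (Lower ?R A)"
    if "greatest S (e s) (Lower S (e ` A))" "A \<subseteq> X" "s \<in> X" for s A
  proof (rule greatest_LowerI)
    show "s \<sqsubseteq>\<^bsub>?R\<^esub> x" if "x \<in> A" for x
      unfolding pull_simps
      by (rule greatest_Lower_below[OF \<open>greatest S (e s) _\<close>]) (use that \<open>A \<subseteq> X\<close> car in auto)
    show "y \<sqsubseteq>\<^bsub>?R\<^esub> s" if "y \<in> Lower ?R A" for y
    proof -
      have "e y \<in> Lower S (e ` A)" using that \<open>A \<subseteq> X\<close> car by (auto simp: Lower_def)
      then show ?thesis using greatest_le[OF \<open>greatest S (e s) _\<close>] by simp
    qed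
  qed (use that in auto)
  have sup_ex: "\<exists>s\<in>X. least ?R s (Upper ?R A) \<and> e s = \<Squnion>\<^bsub>S\<^esub> (e ` A)"
    if "A \<subseteq> X" "countable A" for A
  proof -
    have A: "e ` A \<subseteq> e ` X" "countable (e ` A)" using that by auto
    then have "\<Squnion>\<^bsub>S\<^esub> (e ` A) \<in> e ` X" using sub unfolding sub_sigma_def by blast
    then obtain s where s: "\<Squnion>\<^bsub>S\<^esub> (e ` A) = e s" "s \<in> X" by (rule imageE)
    have "e ` A \<subseteq> carrier S" using that car by auto
    then have "least S (e s) (Upper S (e ` A))" using S.sup_lub[of "e ` A"] A(2) by (simp flip: s(1))
    then show ?thesis using lub[of s A] s that by auto
  qed
  have e_sup: "e (\<Squnion>\<^bsub>?R\<^esub> A) = \<Squnion>\<^bsub>S\<^esub> (e ` A)" if "A \<subseteq> X" "countable A" for A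
    using sup_ex[OF that] R.sup_eqI by auto
  have sub_join: "e x \<squnion>\<^bsub>S\<^esub> e y \<in> e ` X" if "x \<in> X" "y \<in> X" for x y
    using sub that unfolding sub_sigma_def join_def by simp
  have sub_compl: "complement S (e x) \<in> e ` X" if "x \<in> X" for x
    using sub that unfolding sub_sigma_def by simp
  have sub_meet: "e x \<sqinter>\<^bsub>S\<^esub> e y \<in> e ` X" if xy: "x \<in> X" "y \<in> X" for x y
  proof -
    obtain x' where x': "complement S (e x) = e x'" "x' \<in> X"
      using sub_compl[OF xy(1)] by (rule imageE)
    obtain y' where y': "complement S (e y) = e y'" "y' \<in> X"
      using sub_compl[OF xy(2)] by (rule imageE)
    obtain z where z: "e x' \<squnion>\<^bsub>S\<^esub> e y' = e z" "z \<in> X"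
      using sub_join[OF x'(2) y'(2)] by (rule imageE)
    show ?thesis
      unfolding S.meet_eq_complement[OF car[OF xy(1)] car[OF xy(2)]] x'(1) y'(1) z(1)
      by (rule sub_compl[OF z(2)])
  qed
  have inf_ex: "\<exists>s\<in>X. greatest ?R s (Lower ?R {x, y}) \<and> e s = e x \<sqinter>\<^bsub>S\<^esub> e y"
    if xy: "x \<in> X" "y \<in> X" for x y
  proof -
    obtain s where s: "e x \<sqinter>\<^bsub>S\<^esub> e y = e s" "s \<in> X" using sub_meet[OF xy] by (rule imageE)
    have "greatest S (e s) (Lower S (e ` {x, y}))"
      using S.meet_glb[of "e x" "e y"] car xy by (simp flip: s(1))
    then show ?thesis using glb[of s "{x, y}"] s xy by auto
  qed
  have e_meet: "e (x \<sqinter>\<^bsub>?R\<^esub> y) = e x \<sqinter>\<^bsub>S\<^esub> e y" if "x \<in> X" "y \<in> X" for x y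
    using inf_ex[OF that] R.inf_eqI unfolding meet_def by auto
  have e_join: "e (x \<squnion>\<^bsub>?R\<^esub> y) = e x \<squnion>\<^bsub>S\<^esub> e y" if "x \<in> X" "y \<in> X" for x y
    using e_sup[of "{x, y}"] that unfolding join_def by simp
  have "\<bottom>\<^bsub>S\<^esub> \<in> e ` X" using sub unfolding sub_sigma_def by blast
  then obtain b where b: "\<bottom>\<^bsub>S\<^esub> = e b" "b \<in> X" by (rule imageE)
  have "\<top>\<^bsub>S\<^esub> \<in> e ` X" using sub unfolding sub_sigma_def by blast
  then obtain t where t: "\<top>\<^bsub>S\<^esub> = e t" "t \<in> X" by (rule imageE)
  interpret R: bounded_lattice ?R
  proof unfold_locales
    show "\<exists>s. least ?R s (Upper ?R {x, y})" if "x \<in> carrier ?R" "y \<in> carrier ?R" for x y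
      using sup_ex[of "{x, y}"] that by auto
    show "\<exists>s. greatest ?R s (Lower ?R {x, y})" if "x \<in> carrier ?R" "y \<in> carrier ?R" for x y
      using inf_ex[of x y] that by auto
    show "\<exists>x. least ?R x (carrier ?R)"
      by (rule exI[of _ b]) (simp add: least_def b(2) car flip: b(1))
    show "\<exists>x. greatest ?R x (carrier ?R)"
      by (rule exI[of _ t]) (simp add: greatest_def t(2) car flip: t(1))
  qed
  have e_bot: "e \<bottom>\<^bsub>?R\<^esub> = \<bottom>\<^bsub>S\<^esub>" 
  proof -
    have "b = \<bottom>\<^bsub>?R\<^esub>"
      by (rule R.bottom_eq) (simp_all add: b(2) car flip: b(1))
    then show ?thesis using b(1) by simp
  qed
  have e_top: "e \<top>\<^bsub>?R\<^esub> = \<top>\<^bsub>S\<^esub>" 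
  proof -
    have "t = \<top>\<^bsub>?R\<^esub>"
      by (rule R.top_eq) (simp_all add: t(2) car flip: t(1))
    then show ?thesis using t(1) by simp
  qed
  have clos: "x \<sqinter>\<^bsub>?R\<^esub> y \<in> X" "x \<squnion>\<^bsub>?R\<^esub> y \<in> X" if "x \<in> X" "y \<in> X" for x y
    using R.meet_closed[of x y] R.join_closed[of x y] that by auto
  have bt: "\<bottom>\<^bsub>?R\<^esub> \<in> X" "\<top>\<^bsub>?R\<^esub> \<in> X" using R.bottom_closed R.top_closed by auto
  have eqI: "x = y" if "x \<in> X" "y \<in> X" "e x = e y" for x y
    using that inj by (meson inj_onD)
  have compl_ex: "\<exists>y\<in>X. x \<sqinter>\<^bsub>?R\<^esub> y = \<bottom>\<^bsub>?R\<^esub> \<and> x \<squnion>\<^bsub>?R\<^esub> y = \<top>\<^bsub>?R\<^esub> \<and> e y = complement S (e x)"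
    if x: "x \<in> X" for x
  proof -
    obtain y where y: "e y = complement S (e x)" "y \<in> X"
      using sub_compl[OF x] by (auto elim!: imageE)
    have "x \<sqinter>\<^bsub>?R\<^esub> y = \<bottom>\<^bsub>?R\<^esub>" "x \<squnion>\<^bsub>?R\<^esub> y = \<top>\<^bsub>?R\<^esub>"
      using y x clos[OF x y(2)] S.complement_facts[OF car[OF x]]
      by (auto intro!: eqI bt simp: e_meet e_join e_bot e_top)
    then show ?thesis using y by blast
  qed
  interpret R: abstract_sigma_algebra ?R
  proof unfold_locales
    fix x y z assume "x \<in> carrier ?R" "y \<in> carrier ?R" "z \<in> carrier ?R"
    then show "x \<sqinter>\<^bsub>?R\<^esub> (y \<squnion>\<^bsub>?R\<^esub> z) = (x \<sqinter>\<^bsub>?R\<^esub> y) \<squnion>\<^bsub>?R\<^esub> (x \<sqinter>\<^bsub>?R\<^esub> z)"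
      by (intro eqI) (auto simp: e_meet e_join clos car S.meet_join_distrib)
  next
    fix x assume "x \<in> carrier ?R"
    then show "\<exists>y\<in>carrier ?R. x \<sqinter>\<^bsub>?R\<^esub> y = \<bottom>\<^bsub>?R\<^esub> \<and> x \<squnion>\<^bsub>?R\<^esub> y = \<top>\<^bsub>?R\<^esub>"
      using compl_ex by auto
  next
    fix A assume "A \<subseteq> carrier ?R" "countable A"
    then show "\<exists>s. least ?R s (Upper ?R A)" using sup_ex[of A] by auto
  qed
  show "abstract_sigma_algebra ?R" by (fact R.abstract_sigma_algebra_axioms)
  have e_compl: "e (complement ?R x) = complement S (e x)" if "x \<in> X" for x
    using compl_ex[OF that] R.complement_eqI[of x] that by auto
  show "sigma_morphism ?R S e"
    unfolding sigma_morphism_def using car e_bot e_top e_compl e_sup by auto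
  show "boolean_morphism B ?R (\<lambda>b. inv_into X e (f b))"
    if B: "boolean_alg B" and f: "boolean_morphism B S f" and im: "f ` carrier B \<subseteq> e ` X"
  proof -
    interpret B: boolean_alg B by (fact B)
    define g where "g = (\<lambda>b. inv_into X e (f b))"
    have g: "g b \<in> X" "e (g b) = f b" if "b \<in> carrier B" for b
      using im that inv_into_into[of "f b" e X] f_inv_into_f[of "f b" e X] by (auto simp: g_def)
    have cc: "complement ?R x \<in> X" if "x \<in> X" for x
      using R.complement_facts(1)[of x] that by simp
    have "boolean_morphism B ?R g"
      unfolding boolean_morphism_def
    proof (intro conjI ballI)
      show "g \<in> carrier B \<rightarrow> carrier ?R" using g by auto
    qed (rule eqI; simp add: g bt cc clos boolean_morphismD[OF f] e_bot e_top e_compl e_join e_meet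
          B.complement_facts)+
    then show ?thesis by (simp add: g_def)
  qed
qed

primrec denote :: "'s gorder \<Rightarrow> ('b \<Rightarrow> 's) \<Rightarrow> 'b sigma_term \<Rightarrow> 's" where
  "denote S f (Gen b) = f b"
| "denote S f (Compl t) = complement S (denote S f t)"
| "denote S f (Join ts) = \<Squnion>\<^bsub>S\<^esub> (range (\<lambda>n. denote S f (ts n)))"

definition sigma_terms :: "'b gorder \<Rightarrow> 'b sigma_term set" where
  "sigma_terms B = {t. set_sigma_term t \<subseteq> carrier B}"

lemma sigma_terms_simps [simp]:
  "Gen b \<in> sigma_terms B \<longleftrightarrow> b \<in> carrier B"
  "Compl t \<in> sigma_terms B \<longleftrightarrow> t \<in> sigma_terms B"
  "Join ts \<in> sigma_terms B \<longleftrightarrow> (\<forall>n. ts n \<in> sigma_terms B)"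
  by (auto simp: sigma_terms_def)

lemma denote_closed:
  assumes S: "abstract_sigma_algebra S" and f: "f \<in> carrier B \<rightarrow> carrier S" and t: "t \<in> sigma_terms B"
  shows "denote S f t \<in> carrier S"
proof -
  interpret S: abstract_sigma_algebra S by (fact S)
  show ?thesis using t
  proof (induction t)
    case (Gen b)
    then show ?case using f by auto
  next
    case (Compl t)
    then show ?case by (simp add: S.complement_facts)
  next
    case (Join ts)
    then have "range (\<lambda>n. denote S f (ts n)) \<subseteq> carrier S" by auto
    then show ?case by (simp add: S.sup_in_carrier)
  qed
qed

lemma denote_morphism:
  assumes S: "abstract_sigma_algebra S" and f: "f \<in> carrier B \<rightarrow> carrier S"
    and g: "sigma_morphism S S' g" and h: "\<And>b. b \<in> carrier B \<Longrightarrow> g (f b) = h b"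
    and t: "t \<in> sigma_terms B"
  shows "g (denote S f t) = denote S' h t"
  using t
proof (induction t)
  case (Gen b)
  then show ?case using h by simp
next
  case (Compl t)
  then show ?case
    using sigma_morphismD(5)[OF g] denote_closed[OF S f] by simp
next
  case (Join ts)
  then have *: "range (\<lambda>n. denote S f (ts n)) \<subseteq> carrier S" using denote_closed[OF S f] by auto
  have "g ` range (\<lambda>n. denote S f (ts n)) = range (\<lambda>n. denote S' h (ts n))"
    using Join by (auto simp: image_image)
  then show ?case using sigma_morphismD(6)[OF g *] by simp
qed

lemma sub_sigma_denote:
  assumes B: "boolean_alg B" and S: "abstract_sigma_algebra S" and f: "boolean_morphism B S f"
  shows "sub_sigma S (denote S f ` sigma_terms B)"
proof -
  interpret B: boolean_alg B by (fact B)
  interpret S: abstract_sigma_algebra S by (fact S)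
  have fc: "f \<in> carrier B \<rightarrow> carrier S" using boolean_morphismD(1)[OF f] by auto
  have bot: "\<bottom>\<^bsub>S\<^esub> \<in> denote S f ` sigma_terms B"
    by (rule image_eqI[of _ _ "Gen \<bottom>\<^bsub>B\<^esub>"]) (use boolean_morphismD(2)[OF f] in auto)
  have top: "\<top>\<^bsub>S\<^esub> \<in> denote S f ` sigma_terms B"
    by (rule image_eqI[of _ _ "Gen \<top>\<^bsub>B\<^esub>"]) (use boolean_morphismD(3)[OF f] in auto)
  have compl: "complement S (denote S f t) \<in> denote S f ` sigma_terms B" if "t \<in> sigma_terms B" for t
    by (rule image_eqI[of _ _ "Compl t"]) (use that in auto)
  have sup: "\<Squnion>\<^bsub>S\<^esub> A \<in> denote S f ` sigma_terms B" if A: "A \<subseteq> denote S f ` sigma_terms B" "countable A" for A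
  proof (cases "A = {}")
    case True
    then show ?thesis using bot S.sup_empty by simp
  next
    case False
    define ts where "ts n = inv_into (sigma_terms B) (denote S f) (from_nat_into A n)" for n
    have "from_nat_into A n \<in> denote S f ` sigma_terms B" for n
      using A from_nat_into[OF False] by blast
    then have ts: "ts n \<in> sigma_terms B" "denote S f (ts n) = from_nat_into A n" for n
      unfolding ts_def by (auto intro: inv_into_into f_inv_into_f)
    have "denote S f (Join ts) = \<Squnion>\<^bsub>S\<^esub> A"
      using ts range_from_nat_into[OF False A(2)] by simp
    then show ?thesis using ts(1) by (intro image_eqI[of _ _ "Join ts"]) auto
  qed
  show ?thesis
    unfolding sub_sigma_def using denote_closed[OF S fc] bot top compl sup by auto
qed

lemma term_copy:
  fixes S :: "'s gorder" and B :: "'b gorder"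
  assumes B: "boolean_alg B" and S: "abstract_sigma_algebra S" and f: "boolean_morphism B S f"
  obtains R :: "'b sigma_term gorder" and g where
    "abstract_sigma_algebra R" "carrier R \<subseteq> sigma_terms B" "boolean_morphism B R g"
    "sigma_morphism R S (denote S f)" "inj_on (denote S f) (carrier R)"
    "\<And>b. b \<in> carrier B \<Longrightarrow> denote S f (g b) = f b"
proof -
  define X where "X = inv_into (sigma_terms B) (denote S f) ` denote S f ` sigma_terms B"
  have X: "X \<subseteq> sigma_terms B" unfolding X_def by (auto intro: inv_into_into)
  have im: "denote S f ` X = denote S f ` sigma_terms B"
    unfolding X_def image_image by (rule image_cong) (auto simp: f_inv_into_f)
  have inj: "inj_on (denote S f) X"
    unfolding X_def by (rule inj_onI) (auto simp: f_inv_into_f)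
  have sub: "sub_sigma S (denote S f ` X)" unfolding im by (rule sub_sigma_denote[OF B S f])
  have fim: "f b \<in> denote S f ` X" if "b \<in> carrier B" for b
    unfolding im by (rule image_eqI[of _ _ "Gen b"]) (use that in auto)
  show thesis
  proof (rule that[of "pull (denote S f) X S" "\<lambda>b. inv_into X (denote S f) (f b)"])
    show "boolean_morphism B (pull (denote S f) X S) (\<lambda>b. inv_into X (denote S f) (f b))"
      by (rule pull_boolean[OF S inj sub B f]) (use fim in auto)
    show "denote S f (inv_into X (denote S f) (f b)) = f b" if "b \<in> carrier B" for b
      by (rule f_inv_into_f[OF fim[OF that]])
  qed (simp_all only: pull_simps pull_alg[OF S inj sub] pull_morphism[OF S inj sub] X inj)
qed

lemma equalizer_sub:
  assumes C: "abstract_sigma_algebra C"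
    and p: "sigma_morphism C S p" and q: "sigma_morphism C S q"
  shows "sub_sigma C {c \<in> carrier C. p c = q c}"
proof -
  interpret C: abstract_sigma_algebra C by (fact C)
  have "\<Squnion>\<^bsub>C\<^esub> A \<in> {c \<in> carrier C. p c = q c}"
    if A: "A \<subseteq> {c \<in> carrier C. p c = q c}" "countable A" for A
  proof -
    have Ac: "A \<subseteq> carrier C" using A by auto
    have "p ` A = q ` A" using A by (auto intro!: image_cong)
    then show ?thesis
      using sigma_morphismD(6)[OF p Ac A(2)] sigma_morphismD(6)[OF q Ac A(2)]
        C.sup_in_carrier[OF Ac A(2)] by simp
  qed
  then show ?thesis
    unfolding sub_sigma_def
    using C.complement_facts(1) sigma_morphismD(3-5)[OF p] sigma_morphismD(3-5)[OF q] by auto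
qed

lemma factors_uniquelyD:
  assumes "factors_uniquely B C \<eta> S" "abstract_sigma_algebra C" "boolean_morphism B S f"
    "sigma_morphism C S p" "sigma_morphism C S q"
    "\<And>b. b \<in> carrier B \<Longrightarrow> p (\<eta> b) = f b" "\<And>b. b \<in> carrier B \<Longrightarrow> q (\<eta> b) = f b"
    "boolean_morphism B C \<eta>" "c \<in> carrier C"
  shows "p c = q c"
proof -
  let ?p = "restrict p (carrier C)" and ?q = "restrict q (carrier C)"
  have \<eta>: "b \<in> carrier B \<Longrightarrow> \<eta> b \<in> carrier C" for b using boolean_morphismD(1) assms(8) by metis
  have "sigma_morphism C S ?p" "sigma_morphism C S ?q"
    using sigma_morphism_cong[OF assms(2) _ assms(4), of ?p]
      sigma_morphism_cong[OF assms(2) _ assms(5), of ?q] by auto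
  then have "?p = ?q"
    using assms(1)[unfolded factors_uniquely_def, rule_format, OF assms(3)] assms(6,7) \<eta>
    by (elim ex1E) (metis restrict_apply' restrict_extensional)
  then show ?thesis using assms(9) by (metis restrict_apply')
qed

lemma free_sigma_algebra_universal:
  fixes B :: "'b gorder" and C :: "'c gorder" and S :: "'s gorder"
  assumes B: "boolean_alg B" and free: "free_sigma_algebra B C \<eta>" and S: "abstract_sigma_algebra S"
  shows "factors_uniquely B C \<eta> S"
  unfolding factors_uniquely_def
proof (intro allI impI ex_ex1I)
  have C: "abstract_sigma_algebra C" and \<eta>: "boolean_morphism B C \<eta>"
    and univ1: "\<And>S :: 'c gorder. abstract_sigma_algebra S \<Longrightarrow> factors_uniquely B C \<eta> S"
    and univ2: "\<And>S :: 'b sigma_term gorder. abstract_sigma_algebra S \<Longrightarrow> factors_uniquely B C \<eta> S"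
    using free unfolding free_sigma_algebra_def by auto
  interpret C: abstract_sigma_algebra C by (fact C)
  have \<eta>c: "b \<in> carrier B \<Longrightarrow> \<eta> b \<in> carrier C" for b using boolean_morphismD(1)[OF \<eta>] .
  fix f :: "'b \<Rightarrow> 's"
  assume f: "boolean_morphism B S f"
  show "\<exists>\<phi>. \<phi> \<in> extensional (carrier C) \<and> sigma_morphism C S \<phi> \<and> (\<forall>b\<in>carrier B. \<phi> (\<eta> b) = f b)"
  proof -
    obtain R :: "'b sigma_term gorder" and g where R: "abstract_sigma_algebra R"
      "boolean_morphism B R g" "sigma_morphism R S (denote S f)"
      "\<And>b. b \<in> carrier B \<Longrightarrow> denote S f (g b) = f b"
      using term_copy[OF B S f] by metis
    obtain \<psi> where \<psi>: "sigma_morphism C R \<psi>" "\<forall>b\<in>carrier B. \<psi> (\<eta> b) = g b"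
      using univ2[OF R(1)] R(2) unfolding factors_uniquely_def by blast
    let ?\<phi> = "restrict (\<lambda>c. denote S f (\<psi> c)) (carrier C)"
    have "sigma_morphism C S ?\<phi>"
      by (rule sigma_morphism_cong[OF C _ sigma_morphism_comp[OF \<psi>(1) R(3)]]) simp
    then show ?thesis using \<psi>(2) R(4) \<eta>c by (intro exI[of _ ?\<phi>]) auto
  qed
  fix p q
  assume p: "p \<in> extensional (carrier C) \<and> sigma_morphism C S p \<and> (\<forall>b\<in>carrier B. p (\<eta> b) = f b)"
    and q: "q \<in> extensional (carrier C) \<and> sigma_morphism C S q \<and> (\<forall>b\<in>carrier B. q (\<eta> b) = f b)"
  let ?E = "{c \<in> carrier C. p c = q c}"
  let ?R = "pull (\<lambda>c. c) ?E C"
  have inj: "inj_on (\<lambda>c. c) ?E" by simp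
  have sub: "sub_sigma C ((\<lambda>c. c) ` ?E)" using equalizer_sub[OF C, of S p q] p q by simp
  have im: "\<eta> ` carrier B \<subseteq> (\<lambda>c. c) ` ?E" using p q \<eta>c by auto
  have inv: "inv_into ?E (\<lambda>c. c) c = c" if "c \<in> ?E" for c
    using f_inv_into_f[of c "\<lambda>c. c" ?E] that by simp
  note R = pull_alg[OF C inj sub]
  have g: "boolean_morphism B ?R (\<lambda>b. inv_into ?E (\<lambda>c. c) (\<eta> b))"
    by (rule pull_boolean[OF C inj sub B \<eta> im])
  obtain \<psi> where \<psi>: "sigma_morphism C ?R \<psi>"
    "\<forall>b\<in>carrier B. \<psi> (\<eta> b) = inv_into ?E (\<lambda>c. c) (\<eta> b)"
    using univ1[OF R] g unfolding factors_uniquely_def by blast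
  have \<psi>\<eta>: "\<psi> (\<eta> b) = \<eta> b" if "b \<in> carrier B" for b
  proof -
    have "\<eta> b \<in> ?E" using im that by auto
    then show ?thesis using \<psi>(2) that inv by simp
  qed
  have \<psi>C: "sigma_morphism C C \<psi>"
    using sigma_morphism_comp[OF \<psi>(1) pull_morphism[OF C inj sub]] by simp
  show "p = q"
  proof (rule extensionalityI)
    fix c assume c: "c \<in> carrier C"
    have "\<psi> c = c"
      by (rule factors_uniquelyD[OF univ1[OF C] C \<eta> \<psi>C sigma_morphism_id \<psi>\<eta> refl \<eta> c])
    moreover have "\<psi> c \<in> ?E" using sigma_morphismD(1)[OF \<psi>(1) c] by simp
    ultimately show "p c = q c" by simp
  qed (use p q in blast)+
qed

definition sigma_product :: "'i set \<Rightarrow> ('i \<Rightarrow> 's gorder) \<Rightarrow> ('i \<Rightarrow> 's) gorder" where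
  "sigma_product I S = \<lparr>carrier = (\<Pi>\<^sub>E i\<in>I. carrier (S i)), eq = (=),
                  le = (\<lambda>x y. \<forall>i\<in>I. x i \<sqsubseteq>\<^bsub>S i\<^esub> y i)\<rparr>"

lemma sigma_product_simps [simp]:
  "carrier (sigma_product I S) = (\<Pi>\<^sub>E i\<in>I. carrier (S i))" "eq (sigma_product I S) = (=)"
  "le (sigma_product I S) x y \<longleftrightarrow> (\<forall>i\<in>I. x i \<sqsubseteq>\<^bsub>S i\<^esub> y i)"
  by (simp_all add: sigma_product_def)

lemma sigma_product:
  fixes S :: "'i \<Rightarrow> 's gorder"
  assumes S: "\<And>i. i \<in> I \<Longrightarrow> abstract_sigma_algebra (S i)"
  shows sigma_product_alg: "abstract_sigma_algebra (sigma_product I S)"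
    and sigma_product_proj: "i \<in> I \<Longrightarrow> sigma_morphism (sigma_product I S) (S i) (\<lambda>x. x i)"
    and sigma_product_tuple: "\<lbrakk>boolean_alg B; \<And>i. i \<in> I \<Longrightarrow> boolean_morphism B (S i) (f i)\<rbrakk> \<Longrightarrow>
      boolean_morphism B (sigma_product I S) (\<lambda>b. \<lambda>i\<in>I. f i b)"
proof -
  let ?P = "sigma_product I S"
  have po: "partial_order (S i)" and bl: "bounded_lattice (S i)" and ba: "boolean_alg (S i)"
    if "i \<in> I" for i
  proof -
    interpret abstract_sigma_algebra "S i" by (rule S[OF that])
    show "partial_order (S i)" "bounded_lattice (S i)" "boolean_alg (S i)" by unfold_locales
  qed
  have wpo: "weak_partial_order (S i)" if "i \<in> I" for i
    using po[OF that] by (rule partial_order.axioms)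
  interpret P: partial_order ?P
  proof unfold_locales
    fix x y assume xy: "x \<sqsubseteq>\<^bsub>?P\<^esub> y" "y \<sqsubseteq>\<^bsub>?P\<^esub> x" "x \<in> carrier ?P" "y \<in> carrier ?P"
    have "x = y"
    proof (rule PiE_ext[of x I _ y])
      show "x i = y i" if "i \<in> I" for i
        by (rule partial_order.le_antisym[OF po[OF that]]) (use xy that in auto)
    qed (use xy in auto)
    then show "x .=\<^bsub>?P\<^esub> y" by simp
  next
    fix x y z assume "x \<sqsubseteq>\<^bsub>?P\<^esub> y" "y \<sqsubseteq>\<^bsub>?P\<^esub> z" "x \<in> carrier ?P" "y \<in> carrier ?P" "z \<in> carrier ?P"
    then show "x \<sqsubseteq>\<^bsub>?P\<^esub> z"
      unfolding sigma_product_simps PiE_iff by (blast intro: weak_partial_order.le_trans[OF wpo])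
  qed (simp_all add: PiE_iff weak_partial_order.le_refl[OF wpo])
  have lub: "least ?P s (Upper ?P A)"
    if A: "A \<subseteq> carrier ?P" and s: "s \<in> carrier ?P"
      and l: "\<And>i. i \<in> I \<Longrightarrow> least (S i) (s i) (Upper (S i) ((\<lambda>x. x i) ` A))" for s A
  proof (rule least_UpperI)
    fix x assume x: "x \<in> A"
    show "x \<sqsubseteq>\<^bsub>?P\<^esub> s"
      unfolding sigma_product_simps
    proof
      fix i assume i: "i \<in> I"
      show "x i \<sqsubseteq>\<^bsub>S i\<^esub> s i"
        by (rule least_Upper_above[OF l[OF i]]) (use A x i in auto)
    qed
  next
    fix y assume y: "y \<in> Upper ?P A"
    show "s \<sqsubseteq>\<^bsub>?P\<^esub> y"
      unfolding sigma_product_simps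
    proof
      fix i assume i: "i \<in> I"
      have "y i \<in> Upper (S i) ((\<lambda>x. x i) ` A)" using y A i by (auto simp: Upper_def)
      then show "s i \<sqsubseteq>\<^bsub>S i\<^esub> y i" by (rule least_le[OF l[OF i]])
    qed
  qed (fact A, fact s)
  have glb: "greatest ?P s (Lower ?P A)"
    if A: "A \<subseteq> carrier ?P" and s: "s \<in> carrier ?P"
      and l: "\<And>i. i \<in> I \<Longrightarrow> greatest (S i) (s i) (Lower (S i) ((\<lambda>x. x i) ` A))" for s A
  proof (rule greatest_LowerI)
    fix x assume x: "x \<in> A"
    show "s \<sqsubseteq>\<^bsub>?P\<^esub> x"
      unfolding sigma_product_simps
    proof
      fix i assume i: "i \<in> I"
      show "s i \<sqsubseteq>\<^bsub>S i\<^esub> x i"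
        by (rule greatest_Lower_below[OF l[OF i]]) (use A x i in auto)
    qed
  next
    fix y assume y: "y \<in> Lower ?P A"
    show "y \<sqsubseteq>\<^bsub>?P\<^esub> s"
      unfolding sigma_product_simps
    proof
      fix i assume i: "i \<in> I"
      have "y i \<in> Lower (S i) ((\<lambda>x. x i) ` A)" using y A i by (auto simp: Lower_def)
      then show "y i \<sqsubseteq>\<^bsub>S i\<^esub> s i" by (rule greatest_le[OF l[OF i]])
    qed
  qed (fact A, fact s)
  have sup: "least ?P (\<lambda>i\<in>I. \<Squnion>\<^bsub>S i\<^esub> ((\<lambda>x. x i) ` A)) (Upper ?P A)"
    if A: "A \<subseteq> carrier ?P" "countable A" for A
  proof -
    have 1: "least (S i) (\<Squnion>\<^bsub>S i\<^esub> ((\<lambda>x. x i) ` A)) (Upper (S i) ((\<lambda>x. x i) ` A))" if "i \<in> I" for i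
      by (rule abstract_sigma_algebra.sup_lub[OF S[OF that]]) (use A that in auto)
    then have 2: "\<Squnion>\<^bsub>S i\<^esub> ((\<lambda>x. x i) ` A) \<in> carrier (S i)" if "i \<in> I" for i
      using that least_closed by metis
    show ?thesis by (rule lub) (use A 1 2 in auto)
  qed
  have inf: "greatest ?P (\<lambda>i\<in>I. x i \<sqinter>\<^bsub>S i\<^esub> y i) (Lower ?P {x, y})"
    if xy: "x \<in> carrier ?P" "y \<in> carrier ?P" for x y
  proof -
    have 1: "greatest (S i) (x i \<sqinter>\<^bsub>S i\<^esub> y i) (Lower (S i) {x i, y i})" if "i \<in> I" for i
      by (rule abstract_sigma_algebra.meet_glb[OF S[OF that]]) (use xy that in auto)
    then have 2: "x i \<sqinter>\<^bsub>S i\<^esub> y i \<in> carrier (S i)" if "i \<in> I" for i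
      using that greatest_closed by metis
    show ?thesis by (rule glb) (use xy 1 2 in auto)
  qed
  have bot_car: "\<bottom>\<^bsub>S i\<^esub> \<in> carrier (S i)" "\<And>x. x \<in> carrier (S i) \<Longrightarrow> \<bottom>\<^bsub>S i\<^esub> \<sqsubseteq>\<^bsub>S i\<^esub> x"
    and top_car: "\<top>\<^bsub>S i\<^esub> \<in> carrier (S i)" "\<And>x. x \<in> carrier (S i) \<Longrightarrow> x \<sqsubseteq>\<^bsub>S i\<^esub> \<top>\<^bsub>S i\<^esub>"
    if "i \<in> I" for i
  proof -
    interpret bounded_lattice "S i" by (rule bl[OF that])
    show "\<bottom>\<^bsub>S i\<^esub> \<in> carrier (S i)" "\<And>x. x \<in> carrier (S i) \<Longrightarrow> \<bottom>\<^bsub>S i\<^esub> \<sqsubseteq>\<^bsub>S i\<^esub> x"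
      "\<top>\<^bsub>S i\<^esub> \<in> carrier (S i)" "\<And>x. x \<in> carrier (S i) \<Longrightarrow> x \<sqsubseteq>\<^bsub>S i\<^esub> \<top>\<^bsub>S i\<^esub>" by auto
  qed
  interpret P: bounded_lattice ?P
  proof unfold_locales
    show "\<exists>s. least ?P s (Upper ?P {x, y})" if "x \<in> carrier ?P" "y \<in> carrier ?P" for x y
      using sup[of "{x, y}"] that by blast
    show "\<exists>s. greatest ?P s (Lower ?P {x, y})" if "x \<in> carrier ?P" "y \<in> carrier ?P" for x y
      using inf[OF that] by blast
    show "\<exists>x. least ?P x (carrier ?P)"
      by (rule exI[of _ "\<lambda>i\<in>I. \<bottom>\<^bsub>S i\<^esub>"]) (auto simp: least_def bot_car PiE_iff)
    show "\<exists>x. greatest ?P x (carrier ?P)"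
      by (rule exI[of _ "\<lambda>i\<in>I. \<top>\<^bsub>S i\<^esub>"]) (auto simp: greatest_def top_car PiE_iff)
  qed
  have P_sup: "\<Squnion>\<^bsub>?P\<^esub> A = (\<lambda>i\<in>I. \<Squnion>\<^bsub>S i\<^esub> ((\<lambda>x. x i) ` A))" if "A \<subseteq> carrier ?P" "countable A" for A
    using sup[OF that] by (rule P.sup_eqI)
  have P_join: "x \<squnion>\<^bsub>?P\<^esub> y = (\<lambda>i\<in>I. x i \<squnion>\<^bsub>S i\<^esub> y i)"
    if "x \<in> carrier ?P" "y \<in> carrier ?P" for x y
    using P_sup[of "{x, y}"] that by (simp add: join_def)
  have P_meet: "x \<sqinter>\<^bsub>?P\<^esub> y = (\<lambda>i\<in>I. x i \<sqinter>\<^bsub>S i\<^esub> y i)"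
    if "x \<in> carrier ?P" "y \<in> carrier ?P" for x y
    using P.inf_eqI[OF inf[OF that]] by (simp add: meet_def)
  have P_bot: "\<bottom>\<^bsub>?P\<^esub> = (\<lambda>i\<in>I. \<bottom>\<^bsub>S i\<^esub>)"
    by (rule P.bottom_eq[symmetric]) (auto simp: bot_car PiE_iff)
  have P_top: "\<top>\<^bsub>?P\<^esub> = (\<lambda>i\<in>I. \<top>\<^bsub>S i\<^esub>)"
    by (rule P.top_eq[symmetric]) (auto simp: top_car PiE_iff)
  have compl: "(\<lambda>i\<in>I. complement (S i) (x i)) \<in> carrier ?P"
    "x \<sqinter>\<^bsub>?P\<^esub> (\<lambda>i\<in>I. complement (S i) (x i)) = \<bottom>\<^bsub>?P\<^esub>"
    "x \<squnion>\<^bsub>?P\<^esub> (\<lambda>i\<in>I. complement (S i) (x i)) = \<top>\<^bsub>?P\<^esub>" if x: "x \<in> carrier ?P" for x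
  proof -
    have c: "complement (S i) (x i) \<in> carrier (S i)"
      "x i \<sqinter>\<^bsub>S i\<^esub> complement (S i) (x i) = \<bottom>\<^bsub>S i\<^esub>"
      "x i \<squnion>\<^bsub>S i\<^esub> complement (S i) (x i) = \<top>\<^bsub>S i\<^esub>" if "i \<in> I" for i
      using boolean_alg.complement_facts[OF ba[OF that], of "x i"] x that
      by (simp_all add: PiE_iff)
    show 1: "(\<lambda>i\<in>I. complement (S i) (x i)) \<in> carrier ?P" using c by auto
    show "x \<sqinter>\<^bsub>?P\<^esub> (\<lambda>i\<in>I. complement (S i) (x i)) = \<bottom>\<^bsub>?P\<^esub>"
      unfolding P_meet[OF x 1] P_bot by (rule restrict_ext) (simp add: c)
    show "x \<squnion>\<^bsub>?P\<^esub> (\<lambda>i\<in>I. complement (S i) (x i)) = \<top>\<^bsub>?P\<^esub>"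
      unfolding P_join[OF x 1] P_top by (rule restrict_ext) (simp add: c)
  qed
  interpret P: abstract_sigma_algebra ?P
  proof unfold_locales
    fix x y z assume xyz: "x \<in> carrier ?P" "y \<in> carrier ?P" "z \<in> carrier ?P"
    have "x i \<sqinter>\<^bsub>S i\<^esub> (y i \<squnion>\<^bsub>S i\<^esub> z i) = (x i \<sqinter>\<^bsub>S i\<^esub> y i) \<squnion>\<^bsub>S i\<^esub> (x i \<sqinter>\<^bsub>S i\<^esub> z i)" if "i \<in> I" for i
      by (rule boolean_alg.meet_join_distrib[OF ba[OF that]]) (use xyz that in auto)
    then show "x \<sqinter>\<^bsub>?P\<^esub> (y \<squnion>\<^bsub>?P\<^esub> z) = (x \<sqinter>\<^bsub>?P\<^esub> y) \<squnion>\<^bsub>?P\<^esub> (x \<sqinter>\<^bsub>?P\<^esub> z)"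
      using P_meet[OF xyz(1) P.join_closed[OF xyz(2,3)]]
        P_join[OF P.meet_closed[OF xyz(1,2)] P.meet_closed[OF xyz(1,3)]]
        P_meet[OF xyz(1,2)] P_meet[OF xyz(1,3)] P_join[OF xyz(2,3)]
      by (auto intro!: restrict_ext)
  next
    fix x assume "x \<in> carrier ?P"
    then show "\<exists>y\<in>carrier ?P. x \<sqinter>\<^bsub>?P\<^esub> y = \<bottom>\<^bsub>?P\<^esub> \<and> x \<squnion>\<^bsub>?P\<^esub> y = \<top>\<^bsub>?P\<^esub>"
      using compl by blast
  next
    fix A assume "A \<subseteq> carrier ?P" "countable A"
    then show "\<exists>s. least ?P s (Upper ?P A)" using sup by blast
  qed
  show "abstract_sigma_algebra ?P" by (fact P.abstract_sigma_algebra_axioms)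
  have P_compl: "complement ?P x = (\<lambda>i\<in>I. complement (S i) (x i))" if "x \<in> carrier ?P" for x
    using P.complement_eqI[OF that compl[OF that]] .
  show "sigma_morphism ?P (S i) (\<lambda>x. x i)" if "i \<in> I"
    unfolding sigma_morphism_def
  proof (intro conjI allI impI ballI)
    show "(\<Squnion>\<^bsub>?P\<^esub> A) i = \<Squnion>\<^bsub>S i\<^esub> ((\<lambda>x. x i) ` A)" if "A \<subseteq> carrier ?P \<and> countable A" for A
      using P_sup[of A] that \<open>i \<in> I\<close> by simp
    show "complement ?P x i = complement (S i) (x i)" if "x \<in> carrier ?P" for x
      using P_compl[OF that] \<open>i \<in> I\<close> by simp
  qed (use that P_bot P_top in auto)
  show "boolean_morphism B ?P (\<lambda>b. \<lambda>i\<in>I. f i b)"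
    if B: "boolean_alg B" and f: "\<And>i. i \<in> I \<Longrightarrow> boolean_morphism B (S i) (f i)"
  proof -
    have c: "(\<lambda>i\<in>I. f i b) \<in> carrier ?P" if "b \<in> carrier B" for b
      using boolean_morphismD(1)[OF f] that by auto
    show ?thesis
      unfolding boolean_morphism_def
    proof (intro conjI ballI)
      show "(\<lambda>b. \<lambda>i\<in>I. f i b) \<in> carrier B \<rightarrow> carrier ?P" using c by blast
      show "(\<lambda>i\<in>I. f i \<bottom>\<^bsub>B\<^esub>) = \<bottom>\<^bsub>?P\<^esub>" "(\<lambda>i\<in>I. f i \<top>\<^bsub>B\<^esub>) = \<top>\<^bsub>?P\<^esub>"
        unfolding P_bot P_top by (auto intro!: restrict_ext simp: boolean_morphismD[OF f])
      show "(\<lambda>i\<in>I. f i (complement B x)) = complement ?P (\<lambda>i\<in>I. f i x)" if "x \<in> carrier B" for x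
        unfolding P_compl[OF c[OF that]]
        by (rule restrict_ext) (simp add: boolean_morphismD[OF f] that)
      fix x y assume xy: "x \<in> carrier B" "y \<in> carrier B"
      show "(\<lambda>i\<in>I. f i (x \<squnion>\<^bsub>B\<^esub> y)) = (\<lambda>i\<in>I. f i x) \<squnion>\<^bsub>?P\<^esub> (\<lambda>i\<in>I. f i y)"
        unfolding P_join[OF c[OF xy(1)] c[OF xy(2)]]
        by (rule restrict_ext) (simp add: boolean_morphismD[OF f] xy)
      show "(\<lambda>i\<in>I. f i (x \<sqinter>\<^bsub>B\<^esub> y)) = (\<lambda>i\<in>I. f i x) \<sqinter>\<^bsub>?P\<^esub> (\<lambda>i\<in>I. f i y)"
        unfolding P_meet[OF c[OF xy(1)] c[OF xy(2)]]
        by (rule restrict_ext) (simp add: boolean_morphismD[OF f] xy)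
    qed
  qed
qed

lemma free_sigma_algebra_exists:
  fixes B :: "'b gorder"
  assumes B: "boolean_alg B"
  shows "\<exists>(C :: 'b sigma_term gorder) \<eta>. free_sigma_algebra B C \<eta>"
proof -
  define I :: "('b sigma_term gorder \<times> ('b \<Rightarrow> 'b sigma_term)) set"
    where "I = {(S, f). abstract_sigma_algebra S \<and> boolean_morphism B S f}"
  have I: "abstract_sigma_algebra (fst i)" "boolean_morphism B (fst i) (snd i)" if "i \<in> I" for i
    using that unfolding I_def by auto
  let ?P = "sigma_product I fst" and ?h = "\<lambda>b. \<lambda>i\<in>I. snd i b"
  have P: "abstract_sigma_algebra ?P" by (rule sigma_product_alg) (rule I)
  have h: "boolean_morphism B ?P ?h" by (rule sigma_product_tuple[OF I(1) B I(2)])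
  obtain C :: "'b sigma_term gorder" and \<eta> where C: "abstract_sigma_algebra C"
    "carrier C \<subseteq> sigma_terms B" "boolean_morphism B C \<eta>"
    "sigma_morphism C ?P (denote ?P ?h)" "inj_on (denote ?P ?h) (carrier C)"
    "\<And>b. b \<in> carrier B \<Longrightarrow> denote ?P ?h (\<eta> b) = ?h b"
    using term_copy[OF B P h] by metis
  have \<eta>: "\<eta> \<in> carrier B \<rightarrow> carrier C" using boolean_morphismD(1)[OF C(3)] by auto
  have gen: "denote C \<eta> c = c" if c: "c \<in> carrier C" for c
  proof -
    have t: "c \<in> sigma_terms B" using c C(2) by auto
    have "denote ?P ?h (denote C \<eta> c) = denote ?P ?h c"
      by (rule denote_morphism[OF C(1) \<eta> C(4) C(6) t])
    then show ?thesis using inj_onD[OF C(5)] denote_closed[OF C(1) \<eta> t] c by blast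
  qed
  have "factors_uniquely B C \<eta> S" if S: "abstract_sigma_algebra S" for S :: "'b sigma_term gorder"
    unfolding factors_uniquely_def
  proof (intro allI impI ex_ex1I)
    fix f assume f: "boolean_morphism B S f"
    have i: "(S, f) \<in> I" using S f unfolding I_def by simp
    let ?\<phi> = "restrict (\<lambda>c. denote ?P ?h c (S, f)) (carrier C)"
    have "sigma_morphism C S (\<lambda>c. denote ?P ?h c (S, f))"
      using sigma_morphism_comp[OF C(4) sigma_product_proj[OF I(1) i]] by simp
    then have "sigma_morphism C S ?\<phi>" by (rule sigma_morphism_cong[OF C(1), rotated]) simp
    moreover have "?\<phi> (\<eta> b) = f b" if "b \<in> carrier B" for b
      using C(6)[OF that] \<eta> that i by auto
    ultimately show "\<exists>\<phi>. \<phi> \<in> extensional (carrier C) \<and> sigma_morphism C S \<phi> \<and>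
        (\<forall>b\<in>carrier B. \<phi> (\<eta> b) = f b)"
      by (intro exI[of _ ?\<phi>]) auto
  next
    fix f p q
    assume f: "boolean_morphism B S f"
      and p: "p \<in> extensional (carrier C) \<and> sigma_morphism C S p \<and> (\<forall>b\<in>carrier B. p (\<eta> b) = f b)"
      and q: "q \<in> extensional (carrier C) \<and> sigma_morphism C S q \<and> (\<forall>b\<in>carrier B. q (\<eta> b) = f b)"
    show "p = q"
    proof (rule extensionalityI)
      fix c assume c: "c \<in> carrier C"
      then have t: "c \<in> sigma_terms B" using C(2) by auto
      show "p c = q c"
        using denote_morphism[OF C(1) \<eta>, of S p f c] denote_morphism[OF C(1) \<eta>, of S q f c] p q t gen[OF c]
        by simp
    qed (use p q in blast)+
  qed
  then show ?thesis unfolding free_sigma_algebra_def using C(1,3) by blast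
qed

end

theory Submission
  imports Defs
begin

text \<open>Existence. The Stone representation \<open>stone B\<close> identifies \<open>B\<close> with the algebra of clopen sets of
  the space of its ultrafilters, so \<open>\<mu>\<^sub>0\<close> becomes a finitely additive function on an algebra of sets.
  The ultrafilter space is compact: a decreasing sequence of clopen sets with empty intersection
  reaches the empty set (\<open>stone_compact\<close>). Hence this function is continuous at the empty set,
  and Caratheodory's theorem extends it to a measure on the sigma-algebra of sets generated by the
  clopen sets (\<open>stone_measure_exists\<close>). By the universal property, \<open>stone B\<close> extends to a morphism
  from \<open>C\<close> to that sigma-algebra, and the measure is pulled back along this morphism.

  Uniqueness. The elements on which two finite measures of equal total mass agree form a Dynkin
  system. The image of \<open>B\<close> is closed under meets, and it generates \<open>C\<close>
  (\<open>free_sigma_algebra_generated\<close>), so the claim is the pi-lambda theorem (\<open>pi_lambda\<close>) in an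
  abstract sigma-algebra. Its proof is the classical one. Finite Boolean computations are carried
  out on sets of ultrafilters, since the Stone representation is injective and respects finite
  operations; it does not respect countable joins, which are handled by their order-theoretic
  definition and by countable distributivity.\<close>

section \<open>Ultrafilters and the Stone representation\<close>

text \<open>Finite subsets are required to have a nonzero lower bound rather than a nonzero meet, which
  avoids finite meets altogether.\<close>

definition centered :: "('a, 'm) gorder_scheme \<Rightarrow> 'a set \<Rightarrow> bool" where
  "centered L F \<longleftrightarrow> F \<subseteq> carrier L \<and>
     (\<forall>A. finite A \<and> A \<subseteq> F \<longrightarrow> (\<exists>x\<in>carrier L. x \<noteq> \<bottom>\<^bsub>L\<^esub> \<and> (\<forall>a\<in>A. x \<sqsubseteq>\<^bsub>L\<^esub> a)))"

text \<open>Closure under meets and upward closure follow: otherwise the complement of the missing element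
  would be in \<open>U\<close>, and \<open>U\<close> would not be centered.\<close>

definition ultrafilters :: "('a, 'm) gorder_scheme \<Rightarrow> 'a set set" where
  "ultrafilters L = {U. centered L U \<and> (\<forall>a\<in>carrier L. a \<in> U \<or> complement L a \<in> U)}"

definition stone :: "('a, 'm) gorder_scheme \<Rightarrow> 'a \<Rightarrow> 'a set set" where
  "stone L a = {U \<in> ultrafilters L. a \<in> U}"

lemma centeredD:
  assumes "centered L F" "finite A" "A \<subseteq> F"
  obtains x where "x \<in> carrier L" "x \<noteq> \<bottom>\<^bsub>L\<^esub>" "\<And>a. a \<in> A \<Longrightarrow> x \<sqsubseteq>\<^bsub>L\<^esub> a"
  using assms unfolding centered_def by metis

lemma stone_subset: "stone L a \<subseteq> ultrafilters L"
  by (auto simp: stone_def)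

context boolean_alg
begin

lemma le_bottom_iff: "x \<in> carrier L \<Longrightarrow> x \<sqsubseteq> \<bottom> \<longleftrightarrow> x = \<bottom>"
  using le_antisym by auto

lemma disjoint_bounds:
  assumes "x \<in> carrier L" "a \<in> carrier L" "b \<in> carrier L" "x \<sqsubseteq> a" "x \<sqsubseteq> b" "a \<sqinter> b = \<bottom>"
  shows "x = \<bottom>"
  using assms meet_le[of x a b] le_bottom_iff by auto

text \<open>If neither \<open>a\<close> nor its complement could be added to \<open>F\<close>, then below some finite part of \<open>F\<close>
  only \<open>\<bottom>\<close> would lie below \<open>a\<close>, and the same for the complement; a nonzero lower bound of both
  parts is the join of its meets with \<open>a\<close> and with the complement, hence would be \<open>\<bottom>\<close>.\<close>

lemma centered_insert:
  assumes F: "centered L F" and a: "a \<in> carrier L"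
  shows "centered L (insert a F) \<or> centered L (insert (complement L a) F)"
proof -
  have witness: "\<exists>A. finite A \<and> A \<subseteq> F \<and> (\<forall>x\<in>carrier L. (\<forall>u\<in>A. x \<sqsubseteq> u) \<longrightarrow> x \<sqsubseteq> c \<longrightarrow> x = \<bottom>)"
    if "\<not> centered L (insert c F)" "c \<in> carrier L" for c
  proof -
    have "insert c F \<subseteq> carrier L" using F that(2) by (auto simp: centered_def)
    then have "\<not> (\<forall>A. finite A \<and> A \<subseteq> insert c F \<longrightarrow> (\<exists>x\<in>carrier L. x \<noteq> \<bottom> \<and> (\<forall>a\<in>A. x \<sqsubseteq> a)))"
      using that(1) by (simp only: centered_def simp_thms)
    then obtain A where A: "finite A" "A \<subseteq> insert c F"
      "\<not> (\<exists>x\<in>carrier L. x \<noteq> \<bottom> \<and> (\<forall>a\<in>A. x \<sqsubseteq> a))" by metis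
    show ?thesis by (rule exI[of _ "A - {c}"]) (use A in auto)
  qed
  show ?thesis
  proof (rule ccontr)
    assume no: "\<not> ?thesis"
    obtain A where A: "finite A" "A \<subseteq> F"
      "\<And>x. x \<in> carrier L \<Longrightarrow> \<forall>u\<in>A. x \<sqsubseteq> u \<Longrightarrow> x \<sqsubseteq> a \<Longrightarrow> x = \<bottom>"
      using witness[of a] no a by metis
    obtain A' where A': "finite A'" "A' \<subseteq> F"
      "\<And>x. x \<in> carrier L \<Longrightarrow> \<forall>u\<in>A'. x \<sqsubseteq> u \<Longrightarrow> x \<sqsubseteq> complement L a \<Longrightarrow> x = \<bottom>"
      using witness[of "complement L a"] no complement_facts(1)[OF a] by metis
    obtain x where x: "x \<in> carrier L" "x \<noteq> \<bottom>" "\<And>u. u \<in> A \<union> A' \<Longrightarrow> x \<sqsubseteq> u"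
      using centeredD[OF F, of "A \<union> A'"] A(1,2) A'(1,2) by auto
    have Fc: "F \<subseteq> carrier L" using F unfolding centered_def by blast
    have below: "x \<sqinter> c \<in> carrier L" "\<forall>u\<in>A \<union> A'. x \<sqinter> c \<sqsubseteq> u" "x \<sqinter> c \<sqsubseteq> c" if "c \<in> carrier L" for c
    proof -
      show 1: "x \<sqinter> c \<in> carrier L" "x \<sqinter> c \<sqsubseteq> c" using x that by (auto intro: meet_right)
      have "x \<sqinter> c \<sqsubseteq> x" using x that by (auto intro: meet_left)
      then have "x \<sqinter> c \<sqsubseteq> u" if "u \<in> A \<union> A'" for u
        by (rule le_trans[OF _ x(3)[OF that]]) (use x(1) 1 that A(2) A'(2) Fc in auto)
      then show "\<forall>u\<in>A \<union> A'. x \<sqinter> c \<sqsubseteq> u" by blast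
    qed
    have "x \<sqinter> a = \<bottom>" using below[OF a] A(3) by auto
    moreover have "x \<sqinter> complement L a = \<bottom>"
      using below[OF complement_facts(1)[OF a]] A'(3) by auto
    moreover have "x = (x \<sqinter> a) \<squnion> (x \<sqinter> complement L a)"
    proof -
      have "x = x \<sqinter> \<top>" using le_iff_join[of x \<top>] top_higher[OF x(1)] x(1) by blast
      then show ?thesis
        using meet_join_distrib[OF x(1) a complement_facts(1)[OF a]] complement_facts(3)[OF a] by argo
    qed
    ultimately show False using x bottom_join[of \<bottom>] by (simp add: eq_is_equal)
  qed
qed

text \<open>Zorn's lemma: centered sets are closed under unions of chains, and a maximal one is an
  ultrafilter because one of \<open>a\<close> and its complement can always be added.\<close>

lemma centered_extends_to_ultrafilter:
  assumes F: "centered L F"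
  obtains U where "U \<in> ultrafilters L" "F \<subseteq> U"
proof -
  define P where "P = {G. centered L G \<and> F \<subseteq> G}"
  have "\<exists>M\<in>P. \<forall>X\<in>P. M \<subseteq> X \<longrightarrow> X = M"
  proof (rule subset_Zorn_nonempty)
    show "P \<noteq> {}" using F by (auto simp: P_def)
    fix \<C> assume ne: "\<C> \<noteq> {}" and ch: "subset.chain P \<C>"
    have sub: "centered L G" "F \<subseteq> G" if "G \<in> \<C>" for G
      using ch that by (auto simp: subset.chain_def P_def)
    have "centered L (\<Union>\<C>)"
      unfolding centered_def
    proof (intro conjI allI impI)
      show "\<Union>\<C> \<subseteq> carrier L" using sub(1) by (auto simp: centered_def)
      fix A assume "finite A \<and> A \<subseteq> \<Union>\<C>"
      then have A: "finite A" "A \<subseteq> \<Union>\<C>" by auto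
      obtain G where G: "G \<in> \<C>" "A \<subseteq> G"
        by (rule finite_subset_Union_chain[OF A ne ch])
      obtain x where "x \<in> carrier L" "x \<noteq> \<bottom>" "\<And>a. a \<in> A \<Longrightarrow> x \<sqsubseteq> a"
        using centeredD[OF sub(1)[OF G(1)] A(1) G(2)] by metis
      then show "\<exists>x\<in>carrier L. x \<noteq> \<bottom> \<and> (\<forall>a\<in>A. x \<sqsubseteq> a)" by blast
    qed
    then show "\<Union>\<C> \<in> P" using ne sub(2) by (auto simp: P_def)
  qed
  then obtain U where "U \<in> P" and max: "\<forall>X\<in>P. U \<subseteq> X \<longrightarrow> X = U" by (rule bexE)
  then have U: "centered L U" "F \<subseteq> U" by (auto simp: P_def)
  have max: "X = U" if "centered L X" "U \<subseteq> X" for X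
    using max that U(2) by (simp add: P_def)
  have "U \<in> ultrafilters L"
    unfolding ultrafilters_def
  proof (intro CollectI conjI ballI)
    fix a assume "a \<in> carrier L"
    then show "a \<in> U \<or> complement L a \<in> U"
      using centered_insert[OF U(1), of a] max[of "insert a U"] max[of "insert (complement L a) U"]
      by (metis insertI1 subset_insertI)
  qed (fact U(1))
  then show thesis using U(2) by (rule that)
qed

lemma ultrafilter_no_bound:
  assumes U: "U \<in> ultrafilters L" and A: "finite A" "A \<subseteq> U"
    and bot: "\<And>x. x \<in> carrier L \<Longrightarrow> \<forall>a\<in>A. x \<sqsubseteq> a \<Longrightarrow> x = \<bottom>"
  shows False
  using centeredD[of L U A] assms unfolding ultrafilters_def by auto

lemma ultrafilter_complement:
  assumes U: "U \<in> ultrafilters L" and a: "a \<in> carrier L"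
  shows "complement L a \<in> U \<longleftrightarrow> a \<notin> U"
proof -
  note c = complement_facts[OF a]
  have "\<not> (a \<in> U \<and> complement L a \<in> U)"
    using ultrafilter_no_bound[OF U, of "{a, complement L a}"] disjoint_bounds[of _ a "complement L a"] a c
    by auto
  then show ?thesis using U a unfolding ultrafilters_def by auto
qed

lemma ultrafilter_up:
  assumes U: "U \<in> ultrafilters L" and ab: "a \<in> U" "a \<in> carrier L" "b \<in> carrier L" "a \<sqsubseteq> b"
  shows "b \<in> U"
proof (rule ccontr)
  assume "b \<notin> U"
  then have "complement L b \<in> U" using ultrafilter_complement[OF U ab(3)] by simp
  moreover have "x = \<bottom>" if "x \<in> carrier L" "x \<sqsubseteq> a" "x \<sqsubseteq> complement L b" for x
    using disjoint_bounds[of x b "complement L b"] that ab complement_facts[OF ab(3)] le_trans[of x a b]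
    by auto
  ultimately show False
    using ultrafilter_no_bound[OF U, of "{a, complement L b}"] ab(1) by auto
qed

lemma ultrafilter_meet:
  assumes U: "U \<in> ultrafilters L" and a: "a \<in> carrier L" and b: "b \<in> carrier L"
  shows "a \<sqinter> b \<in> U \<longleftrightarrow> a \<in> U \<and> b \<in> U"
proof
  assume "a \<sqinter> b \<in> U"
  then show "a \<in> U \<and> b \<in> U"
    using ultrafilter_up[OF U, of "a \<sqinter> b"] a b by (simp add: meet_left meet_right)
next
  assume ab: "a \<in> U \<and> b \<in> U"
  show "a \<sqinter> b \<in> U"
  proof (rule ccontr)
    assume "a \<sqinter> b \<notin> U"
    then have "complement L (a \<sqinter> b) \<in> U" using ultrafilter_complement[OF U] a b by simp
    moreover have "x = \<bottom>" if "x \<in> carrier L" "x \<sqsubseteq> a" "x \<sqsubseteq> b" "x \<sqsubseteq> complement L (a \<sqinter> b)" for x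
      using disjoint_bounds[of x "a \<sqinter> b" "complement L (a \<sqinter> b)"] that a b meet_le[of x a b]
        complement_facts[of "a \<sqinter> b"] by auto
    ultimately show False
      using ultrafilter_no_bound[OF U, of "{a, b, complement L (a \<sqinter> b)}"] ab by auto
  qed
qed

lemma complement_complement: "a \<in> carrier L \<Longrightarrow> complement L (complement L a) = a"
  using complement_eqI[of "complement L a" a] complement_facts[of a]
  by (simp add: meet_comm join_comm)

lemma join_eq_complement:
  assumes "a \<in> carrier L" "b \<in> carrier L"
  shows "a \<squnion> b = complement L (complement L a \<sqinter> complement L b)"
  using meet_eq_complement[of "complement L a" "complement L b"] assms
  by (simp add: complement_complement complement_facts)

lemma ultrafilter_join:
  assumes U: "U \<in> ultrafilters L" and a: "a \<in> carrier L" and b: "b \<in> carrier L"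
  shows "a \<squnion> b \<in> U \<longleftrightarrow> a \<in> U \<or> b \<in> U"
  using a b by (simp add: join_eq_complement ultrafilter_complement[OF U] ultrafilter_meet[OF U]
      complement_facts)

lemma stone_complement: "a \<in> carrier L \<Longrightarrow> stone L (complement L a) = ultrafilters L - stone L a"
  by (auto simp: stone_def ultrafilter_complement)

lemma stone_meet:
  "\<lbrakk>a \<in> carrier L; b \<in> carrier L\<rbrakk> \<Longrightarrow> stone L (a \<sqinter> b) = stone L a \<inter> stone L b"
  by (auto simp: stone_def ultrafilter_meet)

lemma stone_join:
  "\<lbrakk>a \<in> carrier L; b \<in> carrier L\<rbrakk> \<Longrightarrow> stone L (a \<squnion> b) = stone L a \<union> stone L b"
  by (auto simp: stone_def ultrafilter_join)

lemma stone_bottom: "stone L \<bottom> = {}"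
proof -
  have "\<bottom> \<notin> U" if "U \<in> ultrafilters L" for U
    using ultrafilter_no_bound[OF that, of "{\<bottom>}"] le_bottom_iff by auto
  then show ?thesis by (auto simp: stone_def)
qed

lemma stone_top: "stone L \<top> = ultrafilters L"
  using stone_join[of \<bottom> "complement L \<bottom>"] complement_facts[of \<bottom>] stone_complement[of \<bottom>] stone_bottom
  by auto

lemma stone_nonempty:
  assumes "a \<in> carrier L" "a \<noteq> \<bottom>"
  shows "stone L a \<noteq> {}"
proof -
  have "centered L {a}" unfolding centered_def using assms by blast
  then obtain U where "U \<in> ultrafilters L" "a \<in> U"
    by (rule centered_extends_to_ultrafilter) auto
  then show ?thesis by (auto simp: stone_def)
qed

text \<open>If \<open>a \<sqsubseteq> b\<close> fails, then \<open>a \<sqinter> complement L b\<close> is nonzero, so it lies in some ultrafilter.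
  Every finite identity or inequality of a Boolean algebra thus reduces to one between sets.\<close>

lemma le_iff_stone:
  assumes a: "a \<in> carrier L" and b: "b \<in> carrier L"
  shows "a \<sqsubseteq> b \<longleftrightarrow> stone L a \<subseteq> stone L b"
proof
  assume "a \<sqsubseteq> b"
  then have "a = a \<sqinter> b" using le_iff_join[OF a b] by blast
  then show "stone L a \<subseteq> stone L b" using stone_meet[OF a b] by auto
next
  note c = complement_facts[OF b]
  assume "stone L a \<subseteq> stone L b"
  then have "stone L (a \<sqinter> complement L b) = {}"
    using a b c(1) by (simp add: stone_meet stone_complement, blast)
  then have "a \<sqinter> complement L b = \<bottom>"
    using stone_nonempty[of "a \<sqinter> complement L b"] a c(1) by auto
  moreover have "complement L b \<squnion> b = \<top>" using c(3) by (metis join_comm)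
  ultimately show "a \<sqsubseteq> b"
    by (intro compl_unique_le[OF c(1) a b]) (simp_all add: meet_comm)
qed

lemma eq_iff_stone:
  "\<lbrakk>a \<in> carrier L; b \<in> carrier L\<rbrakk> \<Longrightarrow> a = b \<longleftrightarrow> stone L a = stone L b"
  using le_iff_stone[of a b] le_iff_stone[of b a] le_antisym[of a b] by auto

lemmas stone_simps = stone_meet stone_join stone_complement stone_bottom stone_top complement_facts(1)

text \<open>Compactness of the Stone space, for decreasing sequences: nonzero elements whose clopen sets
  decrease form a centered set, and an ultrafilter containing all of them is a common point.\<close>

lemma stone_compact:
  fixes b :: "nat \<Rightarrow> 'a"
  assumes b: "range b \<subseteq> carrier L" and dec: "decseq (\<lambda>n. stone L (b n))"
    and empty: "(\<Inter>n. stone L (b n)) = {}"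
  obtains n where "b n = \<bottom>"
proof -
  have "\<exists>n. b n = \<bottom>"
  proof (rule ccontr)
    assume nz: "\<nexists>n. b n = \<bottom>"
    have "centered L (range b)"
      unfolding centered_def
    proof (intro conjI allI impI)
      fix A assume "finite A \<and> A \<subseteq> range b"
      then obtain I where I: "finite I" "A = b ` I" by (meson finite_subset_image)
      obtain m where m: "\<forall>i\<in>I. i \<le> m" using I(1) finite_nat_set_iff_bounded_le by auto
      have "b m \<sqsubseteq> b i" if "i \<in> I" for i
        using decseqD[OF dec, of i m] m that le_iff_stone[of "b m" "b i"] b by (simp add: range_subsetD)
      then show "\<exists>x\<in>carrier L. x \<noteq> \<bottom> \<and> (\<forall>a\<in>A. x \<sqsubseteq> a)"
        using b nz I(2) by (intro bexI[of _ "b m"]) auto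
    qed (use b in blast)
    then obtain U where "U \<in> ultrafilters L" "range b \<subseteq> U" by (rule centered_extends_to_ultrafilter)
    then have "U \<in> (\<Inter>n. stone L (b n))" by (auto simp: stone_def)
    then show False using empty by blast
  qed
  then show thesis using that by blast
qed

lemma stone_algebra: "algebra (ultrafilters L) (stone L ` carrier L)"
  unfolding algebra_iff_Un
proof (intro conjI ballI)
  show "stone L ` carrier L \<subseteq> Pow (ultrafilters L)" using stone_subset[of L] by auto
  show "{} \<in> stone L ` carrier L"
    by (rule image_eqI[of _ _ \<bottom>]) (auto simp: stone_simps)
  fix A assume "A \<in> stone L ` carrier L"
  then obtain a where a: "A = stone L a" "a \<in> carrier L" by blast
  show "ultrafilters L - A \<in> stone L ` carrier L"
    by (rule image_eqI[of _ _ "complement L a"]) (auto simp: stone_simps a)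
  fix B assume "B \<in> stone L ` carrier L"
  then obtain b where b: "B = stone L b" "b \<in> carrier L" by blast
  show "A \<union> B \<in> stone L ` carrier L"
    by (rule image_eqI[of _ _ "a \<squnion> b"]) (auto simp: stone_simps a b)
qed


text \<open>An additive function transfers along the Stone isomorphism to the algebra of clopen sets. By
  compactness a decreasing sequence of clopen sets with empty intersection is eventually empty, so
  continuity at the empty set is automatic and Caratheodory's theorem applies.\<close>

lemma stone_measure_exists:
  assumes add: "additive_function L \<mu>\<^sub>0" and fin: "\<And>a. a \<in> carrier L \<Longrightarrow> \<mu>\<^sub>0 a \<noteq> \<infinity>"
  obtains m where
    "measure_space (ultrafilters L) (sigma_sets (ultrafilters L) (stone L ` carrier L)) m"
    "\<And>a. a \<in> carrier L \<Longrightarrow> m (stone L a) = \<mu>\<^sub>0 a"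
proof -
  define f where "f A = \<mu>\<^sub>0 (inv_into (carrier L) (stone L) A)" for A
  have "inj_on (stone L) (carrier L)" by (auto intro!: inj_onI simp: eq_iff_stone)
  then have f: "f (stone L a) = \<mu>\<^sub>0 a" if "a \<in> carrier L" for a
    using that by (simp add: f_def)
  interpret algebra "ultrafilters L" "stone L ` carrier L" by (rule stone_algebra)
  have "positive (stone L ` carrier L) f"
    using f[OF bottom_closed] add by (simp add: positive_def stone_bottom additive_function_def)
  moreover have "additive (stone L ` carrier L) f"
    unfolding Measure_Space.additive_def
  proof (intro ballI impI)
    fix A B assume "A \<in> stone L ` carrier L" "B \<in> stone L ` carrier L" "A \<inter> B = {}"
    then obtain a b where ab: "a \<in> carrier L" "b \<in> carrier L" "A = stone L a" "B = stone L b" by blast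
    have "a \<sqinter> b = \<bottom>" using eq_iff_stone[of "a \<sqinter> b" \<bottom>] ab \<open>A \<inter> B = {}\<close> by (simp add: stone_simps)
    then have "\<mu>\<^sub>0 (a \<squnion> b) = \<mu>\<^sub>0 a + \<mu>\<^sub>0 b" using add ab(1,2) by (simp add: additive_function_def)
    then show "f (A \<union> B) = f A + f B" using ab f[of "a \<squnion> b"] by (simp add: f stone_join)
  qed
  moreover have "f A \<noteq> \<infinity>" if "A \<in> stone L ` carrier L" for A
    using that f fin by auto
  moreover have "(\<lambda>i. f (A i)) \<longlonglongrightarrow> 0"
    if A: "range A \<subseteq> stone L ` carrier L" "decseq A" "(\<Inter>i. A i) = {}" for A
  proof -
    have "\<forall>i. \<exists>a\<in>carrier L. A i = stone L a" using A(1) by blast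
    then obtain b where b: "\<And>i. b i \<in> carrier L" "\<And>i. A i = stone L (b i)" by metis
    have "A = (\<lambda>i. stone L (b i))" using b(2) by (rule ext)
    then have "decseq (\<lambda>i. stone L (b i))" "(\<Inter>i. stone L (b i)) = {}" using A(2,3) by simp_all
    then obtain n where n: "b n = \<bottom>" by (rule stone_compact[rotated]) (use b(1) in auto)
    have "f (A i) = 0" if "n \<le> i" for i
    proof -
      have "A i = stone L \<bottom>" using decseqD[OF A(2) that] n by (simp add: b(2) stone_bottom)
      then show ?thesis using f[OF bottom_closed] add by (simp add: additive_function_def)
    qed
    then show ?thesis by (intro tendsto_eventually eventually_sequentiallyI)
  qed
  ultimately obtain m where "\<forall>A\<in>stone L ` carrier L. m A = f A"
    "measure_space (ultrafilters L) (sigma_sets (ultrafilters L) (stone L ` carrier L)) m"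
    using caratheodory_empty_continuous[of f] by blast
  then show thesis using that[of m] f by simp
qed

end

section \<open>Sigma-algebras of sets\<close>

definition set_order :: "'a set set \<Rightarrow> 'a set gorder" where
  "set_order M = \<lparr>carrier = M, eq = (=), le = (\<subseteq>)\<rparr>"

lemma set_order_simps [simp]:
  "carrier (set_order M) = M" "eq (set_order M) = (=)" "le (set_order M) = (\<subseteq>)"
  by (simp_all add: set_order_def)

lemma set_order:
  assumes "sigma_algebra \<Omega> M"
  shows set_order_abstract_sigma_algebra: "abstract_sigma_algebra (set_order M)"
    and set_order_sup: "\<lbrakk>\<A> \<subseteq> M; countable \<A>\<rbrakk> \<Longrightarrow> \<Squnion>\<^bsub>set_order M\<^esub> \<A> = \<Union>\<A>"
    and set_order_bottom: "\<bottom>\<^bsub>set_order M\<^esub> = {}"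
    and set_order_top: "\<top>\<^bsub>set_order M\<^esub> = \<Omega>"
    and set_order_join: "\<lbrakk>A \<in> M; B \<in> M\<rbrakk> \<Longrightarrow> A \<squnion>\<^bsub>set_order M\<^esub> B = A \<union> B"
    and set_order_meet: "\<lbrakk>A \<in> M; B \<in> M\<rbrakk> \<Longrightarrow> A \<sqinter>\<^bsub>set_order M\<^esub> B = A \<inter> B"
    and set_order_complement: "A \<in> M \<Longrightarrow> complement (set_order M) A = \<Omega> - A"
proof -
  interpret M: sigma_algebra \<Omega> M by fact
  let ?S = "set_order M"
  interpret S: partial_order ?S by unfold_locales auto
  have lub: "least ?S (\<Union>\<A>) (Upper ?S \<A>)" if "\<A> \<subseteq> M" "countable \<A>" for \<A>
    using that M.countable_Union[of \<A>] by (intro least_UpperI) (auto simp: Upper_def)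
  have glb: "greatest ?S (A \<inter> B) (Lower ?S {A, B})" if "A \<in> M" "B \<in> M" for A B
    using that by (intro greatest_LowerI) (auto simp: Lower_def)
  interpret S: bounded_lattice ?S
  proof unfold_locales
    show "\<exists>s. least ?S s (Upper ?S {A, B})" if "A \<in> carrier ?S" "B \<in> carrier ?S" for A B
      using lub[of "{A, B}"] that by auto
    show "\<exists>s. greatest ?S s (Lower ?S {A, B})" if "A \<in> carrier ?S" "B \<in> carrier ?S" for A B
      using glb[of A B] that by auto
    show "\<exists>x. least ?S x (carrier ?S)" by (rule exI[of _ "{}"]) (simp add: least_def)
    show "\<exists>x. greatest ?S x (carrier ?S)"
      using M.sets_into_space by (intro exI[of _ \<Omega>]) (auto simp: greatest_def)
  qed
  show sup: "\<Squnion>\<^bsub>?S\<^esub> \<A> = \<Union>\<A>" if "\<A> \<subseteq> M" "countable \<A>" for \<A>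
    by (rule S.sup_eqI[OF lub[OF that]])
  show bot: "\<bottom>\<^bsub>?S\<^esub> = {}" by (rule S.bottom_eq[symmetric]) auto
  show top: "\<top>\<^bsub>?S\<^esub> = \<Omega>" using M.sets_into_space by (intro S.top_eq[symmetric]) auto
  have join: "A \<squnion>\<^bsub>?S\<^esub> B = A \<union> B" if "A \<in> M" "B \<in> M" for A B
    using sup[of "{A, B}"] that by (simp add: join_def)
  have meet: "A \<sqinter>\<^bsub>?S\<^esub> B = A \<inter> B" if "A \<in> M" "B \<in> M" for A B
    using S.inf_eqI[OF glb[OF that]] by (simp add: meet_def)
  interpret S: abstract_sigma_algebra ?S
  proof unfold_locales
    fix A B C assume "A \<in> carrier ?S" "B \<in> carrier ?S" "C \<in> carrier ?S"
    then show "A \<sqinter>\<^bsub>?S\<^esub> (B \<squnion>\<^bsub>?S\<^esub> C) = (A \<sqinter>\<^bsub>?S\<^esub> B) \<squnion>\<^bsub>?S\<^esub> (A \<sqinter>\<^bsub>?S\<^esub> C)"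
      by (simp add: join meet M.Int M.Un Int_Un_distrib)
  next
    fix A assume "A \<in> carrier ?S"
    then show "\<exists>B\<in>carrier ?S. A \<sqinter>\<^bsub>?S\<^esub> B = \<bottom>\<^bsub>?S\<^esub> \<and> A \<squnion>\<^bsub>?S\<^esub> B = \<top>\<^bsub>?S\<^esub>"
      using M.sets_into_space M.compl_sets[of A]
      by (intro bexI[of _ "\<Omega> - A"]) (auto simp: join meet bot top)
  next
    fix \<A> assume "\<A> \<subseteq> carrier ?S" "countable \<A>"
    then show "\<exists>s. least ?S s (Upper ?S \<A>)" using lub[of \<A>] by auto
  qed
  show "abstract_sigma_algebra ?S" by (fact S.abstract_sigma_algebra_axioms)
  show "A \<squnion>\<^bsub>?S\<^esub> B = A \<union> B" "A \<sqinter>\<^bsub>?S\<^esub> B = A \<inter> B" if "A \<in> M" "B \<in> M"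
    using join meet that by auto
  show "complement ?S A = \<Omega> - A" if "A \<in> M"
    using M.sets_into_space[OF that] M.compl_sets[OF that] that
    by (intro S.complement_eqI) (auto simp: join meet bot top)
qed

lemma stone_boolean_morphism:
  assumes B: "boolean_alg B" and M: "sigma_algebra (ultrafilters B) M" and sub: "stone B ` carrier B \<subseteq> M"
  shows "boolean_morphism B (set_order M) (stone B)"
proof -
  interpret B: boolean_alg B by (fact B)
  have "stone B b \<in> M" if "b \<in> carrier B" for b using sub that by auto
  then show ?thesis
    unfolding boolean_morphism_def
    by (auto simp: B.stone_simps set_order_bottom[OF M] set_order_top[OF M]
        set_order_join[OF M] set_order_meet[OF M] set_order_complement[OF M])
qed

section \<open>Pulling measures back along morphisms\<close>

lemma sigma_morphism_meet:
  assumes X: "boolean_alg X" and Y: "boolean_alg Y" and f: "sigma_morphism X Y f"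
    and x: "x \<in> carrier X" and y: "y \<in> carrier X"
  shows "f (x \<sqinter>\<^bsub>X\<^esub> y) = f x \<sqinter>\<^bsub>Y\<^esub> f y"
proof -
  interpret X: boolean_alg X by (fact X)
  interpret Y: boolean_alg Y by (fact Y)
  note c = X.complement_facts(1)[OF x] X.complement_facts(1)[OF y]
  have "f (complement X x \<squnion>\<^bsub>X\<^esub> complement X y) = complement Y (f x) \<squnion>\<^bsub>Y\<^esub> complement Y (f y)"
    using sigma_morphismD(6)[OF f, of "{complement X x, complement X y}"] c
      sigma_morphismD(5)[OF f x] sigma_morphismD(5)[OF f y] by (simp add: join_def)
  then show ?thesis
    using X.meet_eq_complement[OF x y] Y.meet_eq_complement[of "f x" "f y"] X.join_closed[OF c]
      sigma_morphismD(5)[OF f] sigma_morphismD(1)[OF f] x y by simp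
qed

lemma sigma_measure_comp:
  assumes X: "boolean_alg X" and Y: "boolean_alg Y" and f: "sigma_morphism X Y f"
    and m: "sigma_measure Y m"
  shows "sigma_measure X (\<lambda>x. m (f x))"
  unfolding sigma_measure_def
proof (intro conjI allI impI)
  show "m (f \<bottom>\<^bsub>X\<^esub>) = 0" using sigma_morphismD(3)[OF f] m by (simp add: sigma_measure_def)
  fix a :: "nat \<Rightarrow> 'a"
  assume a: "range a \<subseteq> carrier X \<and> (\<forall>i j. i \<noteq> j \<longrightarrow> a i \<sqinter>\<^bsub>X\<^esub> a j = \<bottom>\<^bsub>X\<^esub>)"
  have "f (a i) \<sqinter>\<^bsub>Y\<^esub> f (a j) = \<bottom>\<^bsub>Y\<^esub>" if "i \<noteq> j" for i j
    using sigma_morphism_meet[OF X Y f, of "a i" "a j"] a that sigma_morphismD(3)[OF f]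
    by (simp add: range_subsetD)
  moreover have "range (\<lambda>i. f (a i)) \<subseteq> carrier Y" using a sigma_morphismD(1)[OF f] by auto
  ultimately have "m (\<Squnion>\<^bsub>Y\<^esub> (range (\<lambda>i. f (a i)))) = (\<Sum>i. m (f (a i)))"
    using m by (simp add: sigma_measure_def)
  then show "m (f (\<Squnion>\<^bsub>X\<^esub> (range a))) = (\<Sum>i. m (f (a i)))"
    using sigma_morphismD(6)[OF f, of "range a"] a by (simp add: image_image)
qed

lemma sigma_measure_cong:
  assumes X: "abstract_sigma_algebra X" and eq: "\<And>x. x \<in> carrier X \<Longrightarrow> m x = m' x"
    and m: "sigma_measure X m"
  shows "sigma_measure X m'"
proof -
  interpret X: abstract_sigma_algebra X by (fact X)
  have "m' (\<Squnion>\<^bsub>X\<^esub> (range a)) = (\<Sum>i. m' (a i))"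
    if a: "range a \<subseteq> carrier X" "\<forall>i j. i \<noteq> j \<longrightarrow> a i \<sqinter>\<^bsub>X\<^esub> a j = \<bottom>\<^bsub>X\<^esub>" for a :: "nat \<Rightarrow> 'a"
  proof -
    have "m (\<Squnion>\<^bsub>X\<^esub> (range a)) = (\<Sum>i. m (a i))" using m a by (simp add: sigma_measure_def)
    moreover have "m (a i) = m' (a i)" for i using a(1) eq by auto
    ultimately show ?thesis using eq[OF X.sup_in_carrier[OF a(1)]] by simp
  qed
  then show ?thesis using m eq[OF X.bottom_closed] by (simp add: sigma_measure_def)
qed

lemma measure_space_sigma_measure:
  assumes "measure_space \<Omega> M m"
  shows "sigma_measure (set_order M) m"
proof -
  have M: "sigma_algebra \<Omega> M" and pos: "positive M m" and ca: "countably_additive M m"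
    using assms by (auto simp: measure_space_def)
  interpret M: sigma_algebra \<Omega> M by (fact M)
  have "m (\<Squnion>\<^bsub>set_order M\<^esub> (range A)) = (\<Sum>i. m (A i))"
    if A: "range A \<subseteq> M" "\<forall>i j. i \<noteq> j \<longrightarrow> A i \<sqinter>\<^bsub>set_order M\<^esub> A j = \<bottom>\<^bsub>set_order M\<^esub>" for A :: "nat \<Rightarrow> 'a set"
  proof -
    have "A i \<inter> A j = {}" if "i \<noteq> j" for i j
      using A that set_order_meet[OF M, of "A i" "A j"] set_order_bottom[OF M] by auto
    then have "disjoint_family A" by (auto simp: disjoint_family_on_def)
    then show ?thesis
      using ca A(1) set_order_sup[OF M A(1)] M.countable_UN[of A UNIV] by (simp add: countably_additive_def)
  qed
  then show ?thesis
    using pos set_order_bottom[OF M] by (simp add: sigma_measure_def positive_def)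
qed

section \<open>The abstract pi-lambda theorem\<close>

definition dynkin :: "('a, 'm) gorder_scheme \<Rightarrow> 'a set \<Rightarrow> bool" where
  "dynkin L D \<longleftrightarrow> D \<subseteq> carrier L \<and> \<bottom>\<^bsub>L\<^esub> \<in> D \<and> (\<forall>x\<in>D. complement L x \<in> D) \<and>
     (\<forall>a :: nat \<Rightarrow> 'a. range a \<subseteq> D \<and> (\<forall>i j. i \<noteq> j \<longrightarrow> a i \<sqinter>\<^bsub>L\<^esub> a j = \<bottom>\<^bsub>L\<^esub>) \<longrightarrow>
        \<Squnion>\<^bsub>L\<^esub> (range a) \<in> D)"

lemma dynkinD:
  assumes "dynkin L D"
  shows "D \<subseteq> carrier L" "\<bottom>\<^bsub>L\<^esub> \<in> D" "x \<in> D \<Longrightarrow> complement L x \<in> D"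
    "\<lbrakk>\<And>i :: nat. a i \<in> D; \<And>i j. i \<noteq> j \<Longrightarrow> a i \<sqinter>\<^bsub>L\<^esub> a j = \<bottom>\<^bsub>L\<^esub>\<rbrakk> \<Longrightarrow> \<Squnion>\<^bsub>L\<^esub> (range a) \<in> D"
  using assms unfolding dynkin_def by (auto simp: image_subset_iff)

text \<open>Padding with \<open>\<bottom>\<close> turns a binary join into a countable one.\<close>

definition pair_seq :: "('a, 'm) gorder_scheme \<Rightarrow> 'a \<Rightarrow> 'a \<Rightarrow> nat \<Rightarrow> 'a" where
  "pair_seq L x y = (\<lambda>_. \<bottom>\<^bsub>L\<^esub>)(0 := x, 1 := y)"

context abstract_sigma_algebra
begin

lemma sup_upper: "\<lbrakk>A \<subseteq> carrier L; countable A; x \<in> A\<rbrakk> \<Longrightarrow> x \<sqsubseteq> \<Squnion> A"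
  by (rule least_Upper_above[OF sup_lub]) auto

lemma sup_le:
  assumes "A \<subseteq> carrier L" "countable A" "y \<in> carrier L" "\<And>x. x \<in> A \<Longrightarrow> x \<sqsubseteq> y"
  shows "\<Squnion> A \<sqsubseteq> y"
  by (rule least_le[OF sup_lub]) (use assms in \<open>auto simp: Upper_def\<close>)

lemma sup_unique:
  assumes "A \<subseteq> carrier L" "s \<in> carrier L" "\<And>x. x \<in> A \<Longrightarrow> x \<sqsubseteq> s"
    "\<And>y. \<lbrakk>y \<in> carrier L; \<And>x. x \<in> A \<Longrightarrow> x \<sqsubseteq> y\<rbrakk> \<Longrightarrow> s \<sqsubseteq> y"
  shows "\<Squnion> A = s"
proof (rule sup_eqI, rule least_UpperI)
  show "s \<sqsubseteq> y" if "y \<in> Upper L A" for y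
    using that assms(1) by (intro assms(4)) (auto simp: Upper_def)
qed (use assms in auto)

text \<open>Countable distributivity holds because meeting with \<open>a\<close> has the right adjoint
  \<open>y \<mapsto> complement L a \<squnion> y\<close>.\<close>

lemma meet_sup_distrib:
  assumes a: "a \<in> carrier L" and A: "A \<subseteq> carrier L" "countable A"
  shows "a \<sqinter> \<Squnion> A = \<Squnion> ((\<lambda>x. a \<sqinter> x) ` A)"
proof (rule sup_unique[symmetric])
  note S = sup_in_carrier[OF A]
  have adj: "a \<sqinter> x \<sqsubseteq> y \<longleftrightarrow> x \<sqsubseteq> complement L a \<squnion> y" if "x \<in> carrier L" "y \<in> carrier L" for x y
    using a that stone_subset[of L x] by (simp add: le_iff_stone stone_simps) blast
  show "a \<sqinter> \<Squnion> A \<in> carrier L" "(\<lambda>x. a \<sqinter> x) ` A \<subseteq> carrier L" using a A S by auto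
  show "u \<sqsubseteq> a \<sqinter> \<Squnion> A" if "u \<in> (\<lambda>x. a \<sqinter> x) ` A" for u
  proof -
    obtain x where x: "u = a \<sqinter> x" "x \<in> A" using \<open>u \<in> _\<close> by blast
    have "stone L x \<subseteq> stone L (\<Squnion> A)" 
      using sup_upper[OF A x(2)] le_iff_stone[OF subsetD[OF A(1) x(2)] S] by blast
    moreover have "x \<in> carrier L" using x(2) A(1) by blast
    ultimately show ?thesis using x(1) a S by (auto simp: le_iff_stone stone_simps)
  qed
  show "a \<sqinter> \<Squnion> A \<sqsubseteq> y" if y: "y \<in> carrier L" "\<And>u. u \<in> (\<lambda>x. a \<sqinter> x) ` A \<Longrightarrow> u \<sqsubseteq> y" for y
  proof -
    have "x \<sqsubseteq> complement L a \<squnion> y" if "x \<in> A" for x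
      using y(2)[of "a \<sqinter> x"] adj[of x y] that A(1) y(1) by auto
    then have "\<Squnion> A \<sqsubseteq> complement L a \<squnion> y"
      using a y(1) by (intro sup_le[OF A]) (simp_all add: complement_facts)
    then show ?thesis using adj[OF S y(1)] by simp
  qed
qed

lemma pair_seq_closed: "\<lbrakk>x \<in> D; y \<in> D; \<bottom> \<in> D\<rbrakk> \<Longrightarrow> pair_seq L x y i \<in> D"
  by (simp add: pair_seq_def)

lemma pair_seq_disjoint:
  assumes "x \<in> carrier L" "y \<in> carrier L" "x \<sqinter> y = \<bottom>" "i \<noteq> j"
  shows "pair_seq L x y i \<sqinter> pair_seq L x y j = \<bottom>"
proof -
  have "stone L x \<inter> stone L y = {}" using assms(1-3) stone_meet[of x y] stone_bottom by simp
  then have "stone L (pair_seq L x y i) \<inter> stone L (pair_seq L x y j) = {}"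
    using assms(4) by (auto simp: pair_seq_def stone_bottom split: if_splits)
  then show ?thesis
    using assms(1,2) pair_seq_closed[of x "carrier L" y] by (simp add: eq_iff_stone stone_simps)
qed

lemma sup_pair_seq:
  assumes "x \<in> carrier L" "y \<in> carrier L"
  shows "\<Squnion> (range (pair_seq L x y)) = x \<squnion> y"
proof (rule sup_unique)
  show "u \<sqsubseteq> x \<squnion> y" if "u \<in> range (pair_seq L x y)" for u
    using that assms by (auto simp: pair_seq_def join_left join_right split: if_splits)
  show "x \<squnion> y \<sqsubseteq> z" if "z \<in> carrier L" "\<And>u. u \<in> range (pair_seq L x y) \<Longrightarrow> u \<sqsubseteq> z" for z
  proof -
    have "pair_seq L x y 0 \<sqsubseteq> z" "pair_seq L x y 1 \<sqsubseteq> z" using that(2) by blast+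
    then show ?thesis using assms that(1) by (intro join_le) (simp_all add: pair_seq_def)
  qed
qed (use assms pair_seq_closed[of x "carrier L" y] in auto)

lemma dynkin_join:
  assumes D: "dynkin L D" and xy: "x \<in> D" "y \<in> D" "x \<sqinter> y = \<bottom>"
  shows "x \<squnion> y \<in> D"
proof -
  have c: "x \<in> carrier L" "y \<in> carrier L" using dynkinD(1)[OF D] xy by auto
  have "\<Squnion> (range (pair_seq L x y)) \<in> D"
    by (rule dynkinD(4)[OF D]) (use pair_seq_closed pair_seq_disjoint c xy dynkinD(2)[OF D] in auto)
  then show ?thesis using sup_pair_seq[OF c] by simp
qed

text \<open>Countable distributivity transports disjoint joins to the trace on \<open>a\<close>; for complements,
  \<open>a \<sqinter> complement L c\<close> is the proper difference of \<open>a\<close> and \<open>a \<sqinter> c\<close>.\<close>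

lemma dynkin_trace:
  assumes D: "dynkin L D" and a: "a \<in> D"
  shows "dynkin L {c \<in> carrier L. a \<sqinter> c \<in> D}"
  unfolding dynkin_def
proof (intro conjI ballI allI impI)
  have ac: "a \<in> carrier L" using dynkinD(1)[OF D] a by auto
  have "a \<sqinter> \<bottom> = \<bottom>" using ac by (simp add: eq_iff_stone stone_simps)
  then show "\<bottom> \<in> {c \<in> carrier L. a \<sqinter> c \<in> D}" using dynkinD(2)[OF D] by simp
  fix c assume "c \<in> {c \<in> carrier L. a \<sqinter> c \<in> D}"
  then have c: "c \<in> carrier L" "a \<sqinter> c \<in> D" by auto
  \<comment> \<open>A proper difference is the complement of a disjoint join.\<close>
  have "complement L a \<sqinter> (a \<sqinter> c) = \<bottom>"
    using ac c(1) by (simp add: eq_iff_stone stone_simps) blast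
  then have "complement L (complement L a \<squnion> (a \<sqinter> c)) \<in> D"
    using dynkin_join[OF D dynkinD(3)[OF D a] c(2)] dynkinD(3)[OF D] by blast
  moreover have "complement L (complement L a \<squnion> (a \<sqinter> c)) = a \<sqinter> complement L c"
    using ac c(1) stone_subset[of L a] by (simp add: eq_iff_stone stone_simps) blast
  ultimately show "complement L c \<in> {c \<in> carrier L. a \<sqinter> c \<in> D}"
    using c(1) by (simp add: complement_facts)
next
  have ac: "a \<in> carrier L" using dynkinD(1)[OF D] a by auto
  fix c :: "nat \<Rightarrow> 'a"
  assume asm: "range c \<subseteq> {c \<in> carrier L. a \<sqinter> c \<in> D} \<and> (\<forall>i j. i \<noteq> j \<longrightarrow> c i \<sqinter> c j = \<bottom>)"
  then have c: "c i \<in> carrier L" "a \<sqinter> c i \<in> D" for i by auto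
  have rc: "range c \<subseteq> carrier L" "countable (range c)" using c(1) by auto
  have "\<Squnion> (range (\<lambda>i. a \<sqinter> c i)) \<in> D"
  proof (rule dynkinD(4)[OF D c(2)])
    fix i j :: nat assume "i \<noteq> j"
    then have "stone L (c i) \<inter> stone L (c j) = {}"
      using asm stone_meet[OF c(1) c(1), of i j] stone_bottom by auto
    then show "(a \<sqinter> c i) \<sqinter> (a \<sqinter> c j) = \<bottom>"
      using ac c(1) by (simp add: eq_iff_stone stone_simps) blast
  qed
  then show "\<Squnion> (range c) \<in> {c \<in> carrier L. a \<sqinter> c \<in> D}"
    using meet_sup_distrib[OF ac rc] sup_in_carrier[OF rc] by (simp add: image_image)
qed auto

text \<open>The usual disjointification: each term is cut down to the part outside the earlier ones.\<close>

lemma dynkin_meet_closed_sub_sigma: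
  assumes D: "dynkin L D" and meet: "\<And>x y. \<lbrakk>x \<in> D; y \<in> D\<rbrakk> \<Longrightarrow> x \<sqinter> y \<in> D"
  shows "sub_sigma L D"
proof -
  have Dc: "x \<in> carrier L" if "x \<in> D" for x using dynkinD(1)[OF D] that by auto
  have compl_bot: "complement L \<bottom> = \<top>" by (rule complement_eqI) (simp_all add: eq_iff_stone stone_simps)
  then have top: "\<top> \<in> D" using dynkinD(2,3)[OF D] by metis
  have sup: "\<Squnion> A \<in> D" if A: "A \<subseteq> D" "countable A" for A
  proof (cases "A = {}")
    case True
    then show ?thesis using sup_empty dynkinD(2)[OF D] by simp
  next
    case False
    define a where "a = from_nat_into A"
    have A_eq: "A = range a" unfolding a_def using range_from_nat_into[OF False A(2)] by simp
    have a: "a n \<in> D" for n using A(1) A_eq by auto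
    define q where "q = rec_nat \<top> (\<lambda>n r. r \<sqinter> complement L (a n))"
    have q0: "q 0 = \<top>" and qS: "q (Suc n) = q n \<sqinter> complement L (a n)" for n by (simp_all add: q_def)
    have q: "q n \<in> D" for n
      by (induction n) (simp_all add: q0 qS top meet a dynkinD(3)[OF D])
    have sq: "stone L (q n) = ultrafilters L - (\<Union>i<n. stone L (a i))" for n
      by (induction n) (use stone_subset[of L] in
          \<open>auto simp: q0 qS stone_simps Dc[OF q] Dc[OF a] lessThan_Suc\<close>)
    define b where "b n = a n \<sqinter> q n" for n
    have b: "b n \<in> D" for n unfolding b_def by (rule meet[OF a q])
    have sb: "stone L (b n) = stone L (a n) - (\<Union>i<n. stone L (a i))" for n
      using stone_subset[of L "a n"] by (auto simp: b_def stone_meet Dc[OF a] Dc[OF q] sq)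
    have "b i \<sqinter> b j = \<bottom>" if "i \<noteq> j" for i j
    proof -
      have "stone L (b i) \<inter> stone L (b j) = {}"
        using that by (cases i j rule: linorder_cases) (auto simp: sb)
      then show ?thesis by (simp add: eq_iff_stone stone_simps Dc[OF b])
    qed
    then have "\<Squnion> (range b) \<in> D" by (rule dynkinD(4)[OF D b])
    moreover have "\<Squnion> A = \<Squnion> (range b)"
    proof (rule sup_unique)
      have rb: "range b \<subseteq> carrier L" "countable (range b)" using Dc[OF b] by auto
      show "A \<subseteq> carrier L" using A(1) dynkinD(1)[OF D] by auto
      show "\<Squnion> (range b) \<in> carrier L" by (rule sup_in_carrier[OF rb])
      fix x assume "x \<in> A"
      then obtain n where x: "x = a n" using A_eq by blast
      \<comment> \<open>A point of \<open>a n\<close> lies in the piece at the first index where it occurs.\<close>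
      have "stone L (a n) \<subseteq> stone L (\<Squnion> (range b))"
      proof
        fix U assume U: "U \<in> stone L (a n)"
        define k where "k = (LEAST k. U \<in> stone L (a k))"
        have "U \<in> stone L (b k)"
          unfolding sb k_def using U by (auto intro: LeastI dest: not_less_Least)
        moreover have "stone L (b k) \<subseteq> stone L (\<Squnion> (range b))"
          using sup_upper[OF rb, of "b k"] le_iff_stone[OF Dc[OF b] sup_in_carrier[OF rb]] by auto
        ultimately show "U \<in> stone L (\<Squnion> (range b))" by blast
      qed
      then show "x \<sqsubseteq> \<Squnion> (range b)"
        using x le_iff_stone[OF Dc[OF a] sup_in_carrier[OF rb]] by auto
    next
      have rb: "range b \<subseteq> carrier L" "countable (range b)" using Dc[OF b] by auto
      fix y assume y: "y \<in> carrier L" "\<And>x. x \<in> A \<Longrightarrow> x \<sqsubseteq> y"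
      show "\<Squnion> (range b) \<sqsubseteq> y"
      proof (rule sup_le[OF rb y(1)])
        fix u assume "u \<in> range b"
        then obtain n where u: "u = a n \<sqinter> q n" by (auto simp: b_def)
        have "a n \<sqinter> q n \<sqsubseteq> a n" using Dc[OF a] Dc[OF q] by (rule meet_left)
        moreover have "a n \<sqsubseteq> y" using y(2) A_eq by blast
        ultimately show "u \<sqsubseteq> y" using u le_trans[of "a n \<sqinter> q n" "a n" y] Dc[OF a] Dc[OF q] y(1) by auto
      qed
    qed
    ultimately show ?thesis by simp
  qed
  show ?thesis
    unfolding sub_sigma_def using dynkinD(1-3)[OF D] top sup by auto
qed

text \<open>The least Dynkin system \<open>E\<close> around a meet-closed set \<open>G\<close> is meet-closed: the traces above
  show that \<open>a \<sqinter> c \<in> E\<close> for all \<open>c \<in> E\<close>, first for \<open>a \<in> G\<close>, and then, by symmetry, for \<open>a \<in> E\<close>.\<close>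

lemma pi_lambda:
  assumes D: "dynkin L D" "G \<subseteq> D" and meet: "\<And>x y. \<lbrakk>x \<in> G; y \<in> G\<rbrakk> \<Longrightarrow> x \<sqinter> y \<in> G"
  obtains E where "sub_sigma L E" "G \<subseteq> E" "E \<subseteq> D"
proof -
  define E where "E = \<Inter> {D. dynkin L D \<and> G \<subseteq> D}"
  have least: "E \<subseteq> D'" if "dynkin L D'" "G \<subseteq> D'" for D' using that by (auto simp: E_def)
  have GE: "G \<subseteq> E" by (auto simp: E_def)
  have E: "dynkin L E"
    unfolding dynkin_def
  proof (intro conjI ballI allI impI)
    show "E \<subseteq> carrier L" using least[OF D] dynkinD(1)[OF D(1)] by auto
    show "\<bottom> \<in> E" by (auto simp: E_def dynkinD(2))
    show "complement L x \<in> E" if "x \<in> E" for x using that by (auto simp: E_def dynkinD(3))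
    show "\<Squnion> (range a) \<in> E"
      if "range a \<subseteq> E \<and> (\<forall>i j. i \<noteq> j \<longrightarrow> a i \<sqinter> a j = \<bottom>)" for a :: "nat \<Rightarrow> 'a"
      unfolding E_def
    proof (intro InterI)
      fix D' assume "D' \<in> {D. dynkin L D \<and> G \<subseteq> D}"
      then have "dynkin L D'" "E \<subseteq> D'" using least by auto
      then show "\<Squnion> (range a) \<in> D'" using that by (intro dynkinD(4)) auto
    qed
  qed
  have Ec: "x \<in> carrier L" if "x \<in> E" for x using dynkinD(1)[OF E] that by auto
  have 1: "a \<sqinter> c \<in> E" if "a \<in> G" "c \<in> E" for a c
  proof -
    have "G \<subseteq> {c \<in> carrier L. a \<sqinter> c \<in> E}" using that(1) meet GE Ec by auto
    then show ?thesis using least[OF dynkin_trace[OF E, of a]] that GE by auto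
  qed
  have "a \<sqinter> c \<in> E" if "a \<in> E" "c \<in> E" for a c
  proof -
    have "a \<sqinter> g \<in> E" if "g \<in> G" for g
      using 1[OF that \<open>a \<in> E\<close>] by (metis meet_comm)
    then have "G \<subseteq> {c \<in> carrier L. a \<sqinter> c \<in> E}" using GE Ec by auto
    then show ?thesis using least[OF dynkin_trace[OF E that(1)]] that(2) by auto
  qed
  then have "sub_sigma L E" by (rule dynkin_meet_closed_sub_sigma[OF E])
  then show thesis using GE least[OF D] by (rule that)
qed

lemma sigma_measure_join:
  assumes m: "sigma_measure L m" and xy: "x \<in> carrier L" "y \<in> carrier L" "x \<sqinter> y = \<bottom>"
  shows "m (x \<squnion> y) = m x + m y"
proof -
  have "m (\<Squnion> (range (pair_seq L x y))) = (\<Sum>i. m (pair_seq L x y i))"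
    using m pair_seq_disjoint[OF xy] pair_seq_closed[OF xy(1,2)]
    by (simp add: sigma_measure_def image_subset_iff)
  also have "\<dots> = (\<Sum>i\<in>{0, 1}. m (pair_seq L x y i))"
    using m by (intro suminf_finite) (auto simp: pair_seq_def sigma_measure_def)
  also have "\<dots> = m x + m y" by (simp add: pair_seq_def)
  finally show ?thesis using sup_pair_seq[OF xy(1,2)] by simp
qed

lemma sigma_measure_complement:
  assumes "sigma_measure L m" "x \<in> carrier L"
  shows "m x + m (complement L x) = m \<top>"
  using sigma_measure_join[OF assms(1,2) complement_facts(1,2)[OF assms(2)]] complement_facts(3)[OF assms(2)]
  by simp

text \<open>The value at a complement is obtained by subtracting from the total mass, which therefore
  has to be finite.\<close>

lemma dynkin_sigma_measure_eq:
  assumes m: "sigma_measure L m" and m': "sigma_measure L m'"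
    and top: "m \<top> = m' \<top>" and fin: "m \<top> \<noteq> \<infinity>"
  shows "dynkin L {c \<in> carrier L. m c = m' c}"
  unfolding dynkin_def
proof (intro conjI ballI allI impI)
  show "\<bottom> \<in> {c \<in> carrier L. m c = m' c}" using m m' by (simp add: sigma_measure_def)
  fix c assume "c \<in> {c \<in> carrier L. m c = m' c}"
  then have c: "c \<in> carrier L" "m c = m' c" by auto
  have "m c + m (complement L c) = m c + m' (complement L c)"
    using sigma_measure_complement[OF m c(1)] sigma_measure_complement[OF m' c(1)] top c(2) by simp
  moreover have "m c \<noteq> \<infinity>" using sigma_measure_complement[OF m c(1)] fin by auto
  ultimately show "complement L c \<in> {c \<in> carrier L. m c = m' c}"
    using complement_facts(1)[OF c(1)] by (simp add: ennreal_add_left_cancel)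
next
  fix a :: "nat \<Rightarrow> 'a"
  assume a: "range a \<subseteq> {c \<in> carrier L. m c = m' c} \<and> (\<forall>i j. i \<noteq> j \<longrightarrow> a i \<sqinter> a j = \<bottom>)"
  then have ra: "range a \<subseteq> carrier L" "countable (range a)" by auto
  have "m (\<Squnion> (range a)) = (\<Sum>i. m (a i))" "m' (\<Squnion> (range a)) = (\<Sum>i. m' (a i))"
    using m m' a ra(1) unfolding sigma_measure_def by auto
  moreover have "m (a i) = m' (a i)" for i using a by auto
  ultimately show "\<Squnion> (range a) \<in> {c \<in> carrier L. m c = m' c}"
    using sup_in_carrier[OF ra] by simp
qed auto

end

section \<open>Measures on the free sigma-algebra\<close>

text \<open>A sub-sigma-algebra \<open>E\<close> containing the image of \<open>B\<close> receives a morphism from the free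
  algebra; followed by the inclusion of \<open>E\<close> it fixes the image of \<open>B\<close>, so it is the identity.\<close>

lemma free_sigma_algebra_generated:
  fixes B :: "'b gorder" and C :: "'c gorder"
  assumes B: "boolean_alg B" and free: "free_sigma_algebra B C \<eta>"
    and E: "sub_sigma C E" "\<eta> ` carrier B \<subseteq> E"
  shows "carrier C \<subseteq> E"
proof
  fix c assume c: "c \<in> carrier C"
  have C: "abstract_sigma_algebra C" and \<eta>: "boolean_morphism B C \<eta>"
    using free unfolding free_sigma_algebra_def by auto
  have inj: "inj_on (\<lambda>c. c) E" and sub: "sub_sigma C ((\<lambda>c. c) ` E)" and im: "\<eta> ` carrier B \<subseteq> (\<lambda>c. c) ` E"
    using E by simp_all
  have inv: "inv_into E (\<lambda>c. c) (\<eta> b) = \<eta> b" if "b \<in> carrier B" for b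
    by (rule f_inv_into_f) (use im that in blast)
  let ?R = "pull (\<lambda>c. c) E C"
  obtain \<psi> where \<psi>: "sigma_morphism C ?R \<psi>" "\<forall>b\<in>carrier B. \<psi> (\<eta> b) = inv_into E (\<lambda>c. c) (\<eta> b)"
    using free_sigma_algebra_universal[OF B free pull_alg[OF C inj sub]] pull_boolean[OF C inj sub B \<eta> im]
    unfolding factors_uniquely_def by blast
  have \<psi>C: "sigma_morphism C C \<psi>"
    using sigma_morphism_comp[OF \<psi>(1) pull_morphism[OF C inj sub]] by simp
  have "\<psi> c = c"
    by (rule factors_uniquelyD[OF free_sigma_algebra_universal[OF B free C] C \<eta> \<psi>C sigma_morphism_id _ refl \<eta> c])
      (use \<psi>(2) inv in simp)
  then show "c \<in> E" using sigma_morphismD(1)[OF \<psi>(1) c] by simp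
qed

lemma free_sigma_algebra_measure_unique:
  fixes B :: "'b gorder" and C :: "'c gorder"
  assumes B: "boolean_alg B" and free: "free_sigma_algebra B C \<eta>"
    and m: "sigma_measure C m" and m': "sigma_measure C m'"
    and eq: "\<And>b. b \<in> carrier B \<Longrightarrow> m (\<eta> b) = m' (\<eta> b)" and fin: "m \<top>\<^bsub>C\<^esub> \<noteq> \<infinity>"
    and c: "c \<in> carrier C"
  shows "m c = m' c"
proof -
  have C: "abstract_sigma_algebra C" and \<eta>: "boolean_morphism B C \<eta>"
    using free unfolding free_sigma_algebra_def by auto
  interpret B: boolean_alg B by (fact B)
  interpret C: abstract_sigma_algebra C by (fact C)
  have top: "m \<top>\<^bsub>C\<^esub> = m' \<top>\<^bsub>C\<^esub>" using eq[OF B.top_closed] boolean_morphismD(3)[OF \<eta>] by simp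
  obtain E where "sub_sigma C E" "\<eta> ` carrier B \<subseteq> E" "E \<subseteq> {c \<in> carrier C. m c = m' c}"
  proof (rule C.pi_lambda[OF C.dynkin_sigma_measure_eq[OF m m' top fin]])
    show "\<eta> ` carrier B \<subseteq> {c \<in> carrier C. m c = m' c}" using eq boolean_morphismD(1)[OF \<eta>] by auto
    show "x \<sqinter>\<^bsub>C\<^esub> y \<in> \<eta> ` carrier B" if "x \<in> \<eta> ` carrier B" "y \<in> \<eta> ` carrier B" for x y
      using that by (auto simp flip: boolean_morphismD(6)[OF \<eta>])
  qed
  then show ?thesis using free_sigma_algebra_generated[OF B free] c by blast
qed

text \<open>Freeness is used only to map \<open>C\<close> to a sigma-algebra of sets; the measure there comes from
  the compactness of the Stone space.\<close>

lemma free_sigma_algebra_measure_exists: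
  fixes B :: "'b gorder" and C :: "'c gorder"
  assumes B: "boolean_alg B" and free: "free_sigma_algebra B C \<eta>"
    and add: "additive_function B \<mu>\<^sub>0" and fin: "\<And>b. b \<in> carrier B \<Longrightarrow> \<mu>\<^sub>0 b \<noteq> \<infinity>"
  obtains \<mu> where "sigma_measure C \<mu>" "\<And>b. b \<in> carrier B \<Longrightarrow> \<mu> (\<eta> b) = \<mu>\<^sub>0 b"
proof -
  interpret B: boolean_alg B by (fact B)
  have C: "abstract_sigma_algebra C" using free unfolding free_sigma_algebra_def by auto
  let ?M = "sigma_sets (ultrafilters B) (stone B ` carrier B)"
  obtain m where m: "measure_space (ultrafilters B) ?M m"
    "\<And>b. b \<in> carrier B \<Longrightarrow> m (stone B b) = \<mu>\<^sub>0 b"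
    using B.stone_measure_exists[OF add fin] by metis
  have M: "sigma_algebra (ultrafilters B) ?M" using m(1) by (simp add: measure_space_def)
  note S = set_order_abstract_sigma_algebra[OF M]
  have st: "boolean_morphism B (set_order ?M) (stone B)"
    by (rule stone_boolean_morphism[OF B M]) auto
  then obtain \<phi> where \<phi>: "sigma_morphism C (set_order ?M) \<phi>" "\<forall>b\<in>carrier B. \<phi> (\<eta> b) = stone B b"
    using free_sigma_algebra_universal[OF B free S, unfolded factors_uniquely_def, rule_format, OF st]
    by (elim ex1E conjE) (rule that)
  have "sigma_measure C (\<lambda>c. m (\<phi> c))"
    by (rule sigma_measure_comp[OF abstract_sigma_algebra.axioms(1)[OF C]
          abstract_sigma_algebra.axioms(1)[OF S] \<phi>(1) measure_space_sigma_measure[OF m(1)]])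
  then show thesis using that[of "\<lambda>c. m (\<phi> c)"] m(2) \<phi>(2) by simp
qed

theorem theorem13:
  fixes B :: "'b gorder" and C :: "'c gorder"
    and \<eta> :: "'b \<Rightarrow> 'c" and \<mu>\<^sub>0 :: "'b \<Rightarrow> ennreal"
  assumes "boolean_alg B"
    and "free_sigma_algebra B C \<eta>"
    and "\<mu>\<^sub>0 \<in> carrier B \<rightarrow> {0..1}"
    and "additive_function B \<mu>\<^sub>0"
  shows "\<exists>!\<mu>. \<mu> \<in> carrier C \<rightarrow>\<^sub>E {0..1} \<and> sigma_measure C \<mu> \<and> (\<forall>b\<in>carrier B. \<mu> (\<eta> b) = \<mu>\<^sub>0 b)"
proof (rule ex_ex1I)
  interpret B: boolean_alg B by fact
  have C: "abstract_sigma_algebra C" and \<eta>: "boolean_morphism B C \<eta>"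
    using assms(2) unfolding free_sigma_algebra_def by auto
  interpret C: abstract_sigma_algebra C by (fact C)
  have \<eta>c: "\<eta> b \<in> carrier C" if "b \<in> carrier B" for b using boolean_morphismD(1)[OF \<eta> that] .
  have le1: "\<mu>\<^sub>0 b \<le> 1" if "b \<in> carrier B" for b using assms(3) that by auto
  have fin: "\<mu>\<^sub>0 b \<noteq> \<infinity>" if "b \<in> carrier B" for b 
    using neq_top_trans[OF _ le1[OF that]] by simp
  obtain \<mu> where \<mu>: "sigma_measure C \<mu>" "\<And>b. b \<in> carrier B \<Longrightarrow> \<mu> (\<eta> b) = \<mu>\<^sub>0 b"
    using free_sigma_algebra_measure_exists[OF assms(1,2,4) fin] by blast
  have "\<mu> c \<le> 1" if "c \<in> carrier C" for c
  proof -
    have "\<mu> c \<le> \<mu> \<top>\<^bsub>C\<^esub>" using C.sigma_measure_complement[OF \<mu>(1) that] by (metis le_iff_add)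
    also have "\<dots> \<le> 1" using \<mu>(2)[OF B.top_closed] le1[OF B.top_closed] boolean_morphismD(3)[OF \<eta>] by simp
    finally show ?thesis .
  qed
  then have "restrict \<mu> (carrier C) \<in> carrier C \<rightarrow>\<^sub>E {0..1}" by auto
  moreover have "sigma_measure C (restrict \<mu> (carrier C))"
    by (rule sigma_measure_cong[OF C _ \<mu>(1)]) simp
  ultimately show "\<exists>\<mu>. \<mu> \<in> carrier C \<rightarrow>\<^sub>E {0..1} \<and> sigma_measure C \<mu> \<and> (\<forall>b\<in>carrier B. \<mu> (\<eta> b) = \<mu>\<^sub>0 b)"
    using \<mu>(2) \<eta>c by (intro exI[of _ "restrict \<mu> (carrier C)"]) simp
  fix p q
  assume p: "p \<in> carrier C \<rightarrow>\<^sub>E {0..1} \<and> sigma_measure C p \<and> (\<forall>b\<in>carrier B. p (\<eta> b) = \<mu>\<^sub>0 b)"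
    and q: "q \<in> carrier C \<rightarrow>\<^sub>E {0..1} \<and> sigma_measure C q \<and> (\<forall>b\<in>carrier B. q (\<eta> b) = \<mu>\<^sub>0 b)"
  have "p \<top>\<^bsub>C\<^esub> \<noteq> \<infinity>"
    using p fin[OF B.top_closed] boolean_morphismD(3)[OF \<eta>] B.top_closed by metis
  then have "p c = q c" if "c \<in> carrier C" for c
    using free_sigma_algebra_measure_unique[OF assms(1,2), of p q c] p q that by simp
  then show "p = q" using p q by (intro PiE_ext[of p "carrier C" "\<lambda>_. {0..1}" q]) auto
qed

end
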